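(* Consider SDAHB$(\gamma_1,\theta)$ with limiting spectral measure $\mu$, with loss $L$ and rate of convergence defined in the context, and let $\mathfrak{tr}(\mu)=\int\lambda\,\mu(d\lambda)$. With the default parameters $\theta=2$ and $\gamma_1=\theta/\mathfrak{tr}(\mu)$, the rate of convergence is at least $$\frac{\gamma_1\lambda^-\theta}{2\gamma_1\lambda^-+\theta^2}=\frac{2\gamma_1\lambda^-}{2\gamma_1\lambda^-+4}.$$ The fastest possible rate (over all $\gamma_1,\theta>0$ for which the algorithm is convergent, i.e. $\|\mathcal I\|<1$) is at most $\dfrac{4\lambda^-}{\mathfrak{tr}(\mu)}$.
   Context: $\mu$ is a probability measure on $[0,\infty)$ with support $\{0\}\cup[\lambda^-,\lambda^+]$, $0<\lambda^-\le\lambda^+<\infty$, satisfying $\mu([\lambda^-,\lambda^-+\epsilon])\sim\ell\epsilon^\alpha$ as $\epsilon\to0$ for some $\ell,\alpha>0$. $R,\widetilde R\ge0$ are not both zero. The SDAHB loss is the solution of $L(t)=F(t)+\int_0^t\mathcal I(t-s)L(s)\,ds$, $t\ge0$, where, with $\omega=4\lambda\gamma_1-\theta^2$, $$F(t)=\int_0^\infty(R\lambda+\widetilde R)G^{(\lambda)}(t)\,\mu(d\lambda),\qquad G^{(\lambda)}(t)=\tfrac14\Big(1+\tfrac{\theta^2}{\omega}\Big)e^{-t\theta}\big(1-\cos(t\sqrt\omega+\vartheta_1)\big),$$ $$\mathcal I(t)=\int_0^\infty\frac{2\gamma_1^2\lambda^2}{\omega}e^{-t\theta}\big(1-\cos(t\sqrt\omega)\big)\,\mu(d\lambda),$$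 $\cos\vartheta_1=\frac{\theta^2-\omega}{\theta^2+\omega}$, $\sin\vartheta_1=\frac{2\theta\sqrt\omega}{\theta^2+\omega}$; at $\lambda=0$, $G^{(0)}\equiv\frac12$. (For $\omega<0$ use complex square roots and the addition formula for cosine; for $\omega=0$ take the limit.) One has $\|\mathcal I\|=\int_0^\infty\mathcal I(t)\,dt=\frac{\gamma_1}{2\theta}\mathfrak{tr}(\mu)$, and when $\|\mathcal I\|<1$, $L(t)$ converges to a limit $L(\infty)$. Rate of convergence: $\liminf_{t\to\infty}\dfrac{-\log\big(L(t)-L(\infty)\big)}{t}$.
   Formalization: The upper bound leaves out exceptional parameters (possible only if R̃>0) where the coefficient of the leading exponential in L−L(∞) vanishes; there the bound can fail. The rate is defined with |L(t)−L(∞)|, as L may approach its limit from below. *)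

theory Defs
  imports "HOL-Probability.Probability" "HOL-Library.Landau_Symbols"
begin

definition msupport :: "real measure \<Rightarrow> real set" where
  "msupport \<mu> = {x. \<forall>U. open U \<and> x \<in> U \<longrightarrow> emeasure \<mu> U > 0}"

definition spectral_measure :: "real measure \<Rightarrow> real \<Rightarrow> real \<Rightarrow> real \<Rightarrow> real \<Rightarrow> bool" where
  "spectral_measure \<mu> lm lp ell \<alpha> \<longleftrightarrow>
     prob_space \<mu> \<and> sets \<mu> = sets borel \<and> (AE l in \<mu>. 0 \<le> l) \<and>
     0 < lm \<and> lm \<le> lp \<and> msupport \<mu> = {0} \<union> {lm..lp} \<and>
     0 < ell \<and> 0 < \<alpha> \<and>
     asymp_equiv (\<lambda>\<epsilon>. measure \<mu> {lm..lm + \<epsilon>}) (at_right 0) (\<lambda>\<epsilon>. ell * \<epsilon> powr \<alpha>)"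

definition tr :: "real measure \<Rightarrow> real" where
  "tr \<mu> = (LINT l:{0..}|\<mu>. l)"

definition omega :: "real \<Rightarrow> real \<Rightarrow> real \<Rightarrow> real" where
  "omega \<gamma> \<theta> l = 4 * l * \<gamma> - \<theta>^2"

text \<open>In the two formulas below the square root of \<open>omega\<close> is complex, and in the first one
  \<open>cos (t * sqrt omega + vartheta)\<close> is expanded by the addition formula, with
  \<open>cos vartheta = (\<theta>^2 - omega) / (\<theta>^2 + omega)\<close> and
  \<open>sin vartheta = 2 * \<theta> * sqrt omega / (\<theta>^2 + omega)\<close>.  Both expressions are even in the
  square root, so the choice of branch is immaterial and their values are real.\<close>

definition G_formula :: "real \<Rightarrow> real \<Rightarrow> real \<Rightarrow> real \<Rightarrow> real" where
  "G_formula \<gamma> \<theta> t l =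
     (let w = complex_of_real (omega \<gamma> \<theta> l); s = csqrt w;
          th = complex_of_real \<theta>; z = complex_of_real t * s;
          c = (th^2 - w) / (th^2 + w); d = 2 * th * s / (th^2 + w)
      in Re (1/4 * (1 + th^2 / w) * exp (- complex_of_real t * th) *
             (1 - (cos z * c - sin z * d))))"

definition K_formula :: "real \<Rightarrow> real \<Rightarrow> real \<Rightarrow> real \<Rightarrow> real" where
  "K_formula \<gamma> \<theta> t l =
     (let w = complex_of_real (omega \<gamma> \<theta> l); s = csqrt w
      in Re (2 * complex_of_real (\<gamma>^2 * l^2) / w * exp (- complex_of_real (t * \<theta>)) *
             (1 - cos (complex_of_real t * s))))"

text \<open>At \<open>omega = 0\<close> the formulas are replaced by their limits. At \<open>l = 0\<close>, where
  \<open>\<theta>^2 + omega = 0\<close>, the value of \<open>G\<close> is \<open>1/2\<close>.\<close>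

definition G :: "real \<Rightarrow> real \<Rightarrow> real \<Rightarrow> real \<Rightarrow> real" where
  "G \<gamma> \<theta> t l =
     (if l = 0 then 1/2
      else if omega \<gamma> \<theta> l = 0 then Lim (at l) (G_formula \<gamma> \<theta> t)
      else G_formula \<gamma> \<theta> t l)"

definition K :: "real \<Rightarrow> real \<Rightarrow> real \<Rightarrow> real \<Rightarrow> real" where
  "K \<gamma> \<theta> t l =
     (if omega \<gamma> \<theta> l = 0 then Lim (at l) (K_formula \<gamma> \<theta> t) else K_formula \<gamma> \<theta> t l)"

definition forcing :: "real measure \<Rightarrow> real \<Rightarrow> real \<Rightarrow> real \<Rightarrow> real \<Rightarrow> real \<Rightarrow> real" where
  "forcing \<mu> R R' \<gamma> \<theta> t = (LINT l:{0..}|\<mu>. (R * l + R') * G \<gamma> \<theta> t l)"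

definition kernel :: "real measure \<Rightarrow> real \<Rightarrow> real \<Rightarrow> real \<Rightarrow> real" where
  "kernel \<mu> \<gamma> \<theta> t = (LINT l:{0..}|\<mu>. K \<gamma> \<theta> t l)"

definition kernel_norm :: "real measure \<Rightarrow> real \<Rightarrow> real \<Rightarrow> real" where
  "kernel_norm \<mu> \<gamma> \<theta> = (LINT t:{0..}|lborel. kernel \<mu> \<gamma> \<theta> t)"

text \<open>Local integrability is the natural class in which the Volterra equation has exactly one
  solution on \<open>[0,\<infinity>)\<close>; values of \<open>L\<close> at negative times are irrelevant.\<close>

definition sdahb_loss ::
    "real measure \<Rightarrow> real \<Rightarrow> real \<Rightarrow> real \<Rightarrow> real \<Rightarrow> (real \<Rightarrow> real) \<Rightarrow> bool" where
  "sdahb_loss \<mu> R R' \<gamma> \<theta> L \<longleftrightarrow>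
     (\<forall>t\<ge>0. set_integrable lborel {0..t} L) \<and>
     (\<forall>t\<ge>0. L t = forcing \<mu> R R' \<gamma> \<theta> t + (LINT s:{0..t}|lborel. kernel \<mu> \<gamma> \<theta> (t - s) * L s))"

text \<open>For noisy targets (\<open>R' > 0\<close>) the loss may approach its limit from below or cross it. The
  excess loss is therefore measured in absolute value, and \<open>- log 0 = \<infinity>\<close>.\<close>

definition neg_log :: "real \<Rightarrow> ereal" where
  "neg_log d = (if d = 0 then \<infinity> else ereal (- ln \<bar>d\<bar>))"

definition conv_rate :: "(real \<Rightarrow> real) \<Rightarrow> ereal" where
  "conv_rate L = Liminf at_top (\<lambda>t::real. neg_log (L t - Lim at_top L) / ereal t)"

text \<open>If \<open>x\<close> is the Malthusian exponent, that is, \<open>exp (x * t) * kernel t\<close> integrates to \<open>1\<close>,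
  then taking Laplace transforms at \<open>-x\<close> in the renewal equation for \<open>L - L(\<infinity>)\<close> shows that
  the coefficient of \<open>exp (- x * t)\<close> in \<open>L - L(\<infinity>)\<close> is a positive multiple of the difference
  of the two sides of the disequality below. If it vanishes the rate is no
  longer governed by \<open>x\<close> and can exceed \<open>4 * lm / tr \<mu>\<close>, so such exceptional parameters have to be
  left out of the upper bound on the rate. The difference is always positive when \<open>R' = 0\<close>.\<close>

definition nondegenerate :: "real measure \<Rightarrow> real \<Rightarrow> real \<Rightarrow> real \<Rightarrow> real \<Rightarrow> bool" where
  "nondegenerate \<mu> R R' \<gamma> \<theta> \<longleftrightarrow>
     (let F = forcing \<mu> R R' \<gamma> \<theta>; Finf = Lim at_top F in
      \<forall>x>0. (LINT t:{0..}|lborel. exp (x * t) * kernel \<mu> \<gamma> \<theta> t) = 1 \<longrightarrow>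
        (LINT t:{0..}|lborel. exp (x * t) * (F t - Finf)) \<noteq> Finf / x)"

end

theory Submission
  imports Defs "HOL-Complex_Analysis.Complex_Analysis"
begin

text \<open>
Put \<open>k = \<gamma> * l\<close>. The two functions in the definition of the loss are squares of solutions of the damped
oscillator \<open>v'' + \<theta> * v' + k * v = 0\<close>: \<open>K = k\<^sup>2 * y\<^sup>2\<close> with \<open>y(0) = 0, y'(0) = 1\<close>, and \<open>G = u\<^sup>2 / 2\<close> with
\<open>u(0) = 1, u'(0) = 0\<close>. A suitable quadratic form \<open>Q(v, v')\<close> satisfies \<open>(exp (x * t) * Q)' = - exp (x * t) * v\<^sup>2\<close>
and is positive definite as long as \<open>x < \<theta>\<close> and \<open>4 * k - 2 * \<theta> * x + x\<^sup>2 > 0\<close>. This yields the exponentially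
weighted integrals of \<open>K\<close> and \<open>G\<close> for all damping regimes at once, hence the Laplace transform of the kernel at \<open>- x\<close>,
\<open>M x = \<integral> 2 * \<gamma>\<^sup>2 * l\<^sup>2 / ((\<theta> - x) * (4 * \<gamma> * l - 2 * \<theta> * x + x\<^sup>2)) d\<mu>(l)\<close>.

Extend the loss by \<open>0\<close> to negative times. The excess \<open>D = L - Linf\<close> then solves a renewal equation
\<open>D = P + kernel * D\<close> (convolution) on the whole line. If \<open>M x < 1\<close>, taking suprema in that equation shows that \<open>D\<close> is \<open>O(exp (- x * t))\<close>
(\<open>conv_rate_ge\<close>). For the default parameters \<open>M 0 = 1/2\<close>, and \<open>M_upper\<close> gives \<open>M x < 1\<close> at the asserted rate.

For the upper bound, \<open>M x \<le> 1\<close> forces \<open>x \<le> 4 * lm / tr \<mu>\<close> (\<open>rate_le_if_M_le_1\<close>). Suppose that \<open>D\<close> decays at a rate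
\<open>x1\<close> above this value. The two-sided Laplace transform of the renewal equation at \<open>- x\<close> reads \<open>D^ * (1 - M x) = P^\<close>, and
a solution of \<open>M x = 1\<close> below \<open>x1\<close> would make \<open>P^\<close> vanish, which nondegeneracy excludes. Hence \<open>M < 1\<close> up to
the abscissa of convergence \<open>X < x1\<close> of the kernel. Partial fractions express \<open>P^\<close> through \<open>M\<close>, so that
\<open>h (- x) * M x = a (- x)\<close> with functions \<open>h\<close> and \<open>a\<close> that are holomorphic around \<open>- X\<close>, because the transform
of \<open>D\<close> is. Here \<open>h\<close> is not identically zero: this follows from its value at \<open>0\<close> if \<open>R' > 0\<close>, and from its
growth at infinity if \<open>R > 0\<close>. As \<open>M\<close> is bounded, \<open>a / h\<close> continues it holomorphically past the abscissa, and
Landau's theorem (\<open>landau_laplace\<close>) makes the integral of \<open>exp (x * t) * kernel t\<close> converge for some \<open>x > X\<close>. This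
is impossible, since \<open>\<mu>\<close> charges the eigenvalues near \<open>lm\<close> whose oscillators decay too slowly (\<open>kernel_not_integrable\<close>).
\<close>

section \<open>The damped oscillator\<close>

text \<open>The solutions of \<open>s'' = w * s\<close> with initial values \<open>s = 0, s' = 1\<close> and \<open>s = 1, s' = 0\<close>. Taking \<open>w\<close> instead of
its square root as the parameter keeps them real and continuous across \<open>w = 0\<close>.\<close>

definition sn :: "real \<Rightarrow> real \<Rightarrow> real" where
  "sn w t = (if w > 0 then sinh (sqrt w * t) / sqrt w
             else if w < 0 then sin (sqrt (-w) * t) / sqrt (-w) else t)"

definition cs :: "real \<Rightarrow> real \<Rightarrow> real" where
  "cs w t = (if w > 0 then cosh (sqrt w * t)
             else if w < 0 then cos (sqrt (-w) * t) else 1)"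

lemma sn_0 [simp]: "sn w 0 = 0" by (simp add: sn_def)
lemma cs_0 [simp]: "cs w 0 = 1" by (simp add: cs_def)

lemma sn_has_deriv: "(sn w has_real_derivative cs w t) (at t within A)"
proof -
  consider r where "r > 0" "w = r\<^sup>2" | r where "r > 0" "w = - (r\<^sup>2)" | "w = 0"
    by (metis linorder_neqE_linordered_idom neg_0_less_iff_less minus_minus
        real_sqrt_gt_0_iff real_sqrt_pow2 less_imp_le)
  then show ?thesis
    by cases (auto simp: sn_def[abs_def] cs_def real_sqrt_abs intro!: derivative_eq_intros)
qed

lemma cs_has_deriv: "(cs w has_real_derivative w * sn w t) (at t within A)"
proof -
  consider r where "r > 0" "w = r\<^sup>2" | r where "r > 0" "w = - (r\<^sup>2)" | "w = 0"
    by (metis linorder_neqE_linordered_idom neg_0_less_iff_less minus_minus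
        real_sqrt_gt_0_iff real_sqrt_pow2 less_imp_le)
  then show ?thesis
    by cases (auto simp: cs_def[abs_def] sn_def field_simps power2_eq_square
        intro!: derivative_eq_intros)
qed

lemma measurable_sn [measurable]: "(\<lambda>(t, w). sn w t) \<in> borel_measurable (borel \<Otimes>\<^sub>M borel)"
  unfolding sn_def sinh_def by measurable

lemma measurable_cs [measurable]: "(\<lambda>(t, w). cs w t) \<in> borel_measurable (borel \<Otimes>\<^sub>M borel)"
  unfolding cs_def cosh_def by measurable

text \<open>The substitution \<open>v = exp (- \<theta> * t / 2) * s\<close> turns \<open>s'' = (\<theta>\<^sup>2 / 4 - k) * s\<close> into
\<open>v'' + \<theta> * v' + k * v = 0\<close>; the initial values are \<open>y = 0, y' = 1\<close> and \<open>u = 1, u' = 0\<close>.\<close>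

definition osc_y :: "real \<Rightarrow> real \<Rightarrow> real \<Rightarrow> real" where
  "osc_y \<theta> k t = exp (- (\<theta> / 2) * t) * sn (\<theta>\<^sup>2 / 4 - k) t"

definition osc_u :: "real \<Rightarrow> real \<Rightarrow> real \<Rightarrow> real" where
  "osc_u \<theta> k t = exp (- (\<theta> / 2) * t) * (cs (\<theta>\<^sup>2 / 4 - k) t + \<theta> / 2 * sn (\<theta>\<^sup>2 / 4 - k) t)"

lemma osc_y_0 [simp]: "osc_y \<theta> k 0 = 0" and osc_u_0 [simp]: "osc_u \<theta> k 0 = 1"
  by (simp_all add: osc_y_def osc_u_def)

lemma osc_y_deriv: "(osc_y \<theta> k has_real_derivative osc_u \<theta> k t - \<theta> * osc_y \<theta> k t) (at t)"
  unfolding osc_y_def osc_u_def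
  by (auto intro!: derivative_eq_intros sn_has_deriv simp: field_simps)

lemma osc_u_deriv: "(osc_u \<theta> k has_real_derivative - k * osc_y \<theta> k t) (at t)"
  unfolding osc_y_def osc_u_def
  by (auto intro!: derivative_eq_intros sn_has_deriv cs_has_deriv
      simp: field_simps power2_eq_square)

lemma quadratic_form_ge:
  fixes A B C v w :: real
  assumes "C > 0" 
  shows "(A - B\<^sup>2 / (4 * C)) * v\<^sup>2 \<le> A * v\<^sup>2 + B * v * w + C * w\<^sup>2"
proof -
  have "A * v\<^sup>2 + B * v * w + C * w\<^sup>2 - (A - B\<^sup>2 / (4 * C)) * v\<^sup>2 = C * (w + B / (2 * C) * v)\<^sup>2"
    using assms by (simp add: field_simps power2_eq_square)
  moreover have "\<dots> \<ge> 0" using assms by simp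
  ultimately show ?thesis by linarith
qed

text \<open>The characteristic roots of the oscillator have real part below \<open>- x / 2\<close> exactly when \<open>x < \<theta>\<close> and \<open>disc \<theta> k x > 0\<close>.
In Laplace transforms of squares of solutions, \<open>disc\<close> is the denominator \<open>p\<^sup>2 + omega\<close> at \<open>p = \<theta> - x\<close>.\<close>

definition disc :: "real \<Rightarrow> real \<Rightarrow> real \<Rightarrow> real" where
  "disc \<theta> k x = 4 * k - 2 * \<theta> * x + x\<^sup>2"

text \<open>The quadratic form whose weighted derivative along solutions is \<open>- exp (x * t) * v\<^sup>2\<close>. Its coefficients are the unique solution
of the three linear equations obtained by comparing the terms in \<open>v\<^sup>2\<close>, \<open>v * v'\<close> and \<open>v'\<^sup>2\<close>.\<close>

definition osc_form :: "real \<Rightarrow> real \<Rightarrow> real \<Rightarrow> real \<Rightarrow> real \<Rightarrow> real" where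
  "osc_form \<theta> k x a b = 2 / ((\<theta> - x) * disc \<theta> k x) *
     ((k + (\<theta> - x) * (2 * \<theta> - x) / 2) * a\<^sup>2 + (2 * \<theta> - x) * a * b + b\<^sup>2)"

locale damped_oscillator =
  fixes \<theta> k :: real and v v' :: "real \<Rightarrow> real"
  assumes v: "\<And>t. (v has_real_derivative v' t) (at t)"
    and v': "\<And>t. (v' has_real_derivative - \<theta> * v' t - k * v t) (at t)"
begin

lemma osc_form_deriv:
  assumes "x < \<theta>" "disc \<theta> k x > 0"
  shows "((\<lambda>t. exp (x * t) * osc_form \<theta> k x (v t) (v' t)) has_real_derivative
           - (exp (x * t) * (v t)\<^sup>2)) (at t)"
proof -
  define c where "c = 2 / ((\<theta> - x) * disc \<theta> k x)"
  have c: "c * (\<theta> - x) * (4 * k - 2 * \<theta> * x + x\<^sup>2) = 2"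
    using assms unfolding c_def disc_def by (simp add: nonzero_divide_eq_eq)
  have "((\<lambda>t. exp (x * t) * osc_form \<theta> k x (v t) (v' t)) has_real_derivative
      exp (x * t) * (x * c * ((k + (\<theta> - x) * (2 * \<theta> - x) / 2) * (v t)\<^sup>2 + (2 * \<theta> - x) * v t * v' t + (v' t)\<^sup>2) +
       c * ((k + (\<theta> - x) * (2 * \<theta> - x) / 2) * (2 * v t * v' t)
         + (2 * \<theta> - x) * (v' t * v' t + v t * (- \<theta> * v' t - k * v t)) + 2 * v' t * (- \<theta> * v' t - k * v t)))) (at t)"
    unfolding osc_form_def c_def[symmetric]
    by (rule derivative_eq_intros v v' refl | (simp; fail))+
       (simp add: field_simps power2_eq_square)
  also have "x * c * ((k + (\<theta> - x) * (2 * \<theta> - x) / 2) * (v t)\<^sup>2 + (2 * \<theta> - x) * v t * v' t + (v' t)\<^sup>2) +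
       c * ((k + (\<theta> - x) * (2 * \<theta> - x) / 2) * (2 * v t * v' t)
         + (2 * \<theta> - x) * (v' t * v' t + v t * (- \<theta> * v' t - k * v t)) + 2 * v' t * (- \<theta> * v' t - k * v t))
       = - (c * (\<theta> - x) * (4 * k - 2 * \<theta> * x + x\<^sup>2) / 2) * (v t)\<^sup>2"
    by (simp add: field_simps power2_eq_square)
  finally show ?thesis unfolding c by simp
qed

lemma osc_form_ge_sq1:
  assumes "x < \<theta>" "disc \<theta> k x > 0"
  shows "a\<^sup>2 / (2 * (\<theta> - x)) \<le> osc_form \<theta> k x a b"
proof -
  have "2 / ((\<theta> - x) * disc \<theta> k x) * (disc \<theta> k x / 4 * a\<^sup>2) \<le> osc_form \<theta> k x a b"
    unfolding osc_form_def
  proof (intro mult_left_mono)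
    have "disc \<theta> k x / 4 = k + (\<theta> - x) * (2 * \<theta> - x) / 2 - (2 * \<theta> - x)\<^sup>2 / (4 * 1)"
      by (simp add: disc_def field_simps power2_eq_square)
    then show "disc \<theta> k x / 4 * a\<^sup>2 \<le> (k + (\<theta> - x) * (2 * \<theta> - x) / 2) * a\<^sup>2 + (2 * \<theta> - x) * a * b + b\<^sup>2"
      using quadratic_form_ge[of 1 "k + (\<theta> - x) * (2 * \<theta> - x) / 2" "2 * \<theta> - x" a b]
      by (simp only: mult_1 zero_less_one simp_thms)
  qed (use assms in auto)
  also have "2 / ((\<theta> - x) * disc \<theta> k x) * (disc \<theta> k x / 4 * a\<^sup>2) = a\<^sup>2 / (2 * (\<theta> - x))"
    using assms by (simp add: field_simps)
  finally show ?thesis .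
qed

text \<open>Together with the previous lemma: the form is positive definite in the whole range of convergence. Thus it dominates both the
solution and its derivative, and no explicit solution is needed to see that they decay.\<close>

lemma osc_form_ge_sq2:
  assumes "x < \<theta>" "disc \<theta> k x > 0"
  shows "\<exists>c>0. \<forall>a b. c * b\<^sup>2 \<le> osc_form \<theta> k x a b"
proof -
  define A where "A = k + (\<theta> - x) * (2 * \<theta> - x) / 2"
  have A: "4 * A - (2 * \<theta> - x)\<^sup>2 = disc \<theta> k x" 
    by (simp add: A_def disc_def field_simps power2_eq_square)
  with assms have Apos: "A > 0" by (smt (verit) zero_le_power2)
  define c where "c = 2 / ((\<theta> - x) * disc \<theta> k x) * (1 - (2 * \<theta> - x)\<^sup>2 / (4 * A))"
  have "c > 0" unfolding c_def using assms A Apos by (intro mult_pos_pos) (auto simp: field_simps)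
  moreover have "c * b\<^sup>2 \<le> osc_form \<theta> k x a b" for a b
  proof -
    have "(1 - (2 * \<theta> - x)\<^sup>2 / (4 * A)) * b\<^sup>2 \<le> A * a\<^sup>2 + (2 * \<theta> - x) * a * b + b\<^sup>2"
      using quadratic_form_ge[OF Apos, of 1 "2 * \<theta> - x" b a] by (simp add: algebra_simps)
    then show ?thesis unfolding osc_form_def c_def A_def[symmetric]
      using assms by (simp only: mult.assoc) (intro mult_left_mono; simp)
  qed
  ultimately show ?thesis by blast
qed

lemma osc_form_decreasing:
  assumes "x < \<theta>" "disc \<theta> k x > 0" "0 \<le> t"
  shows "exp (x * t) * osc_form \<theta> k x (v t) (v' t) \<le> osc_form \<theta> k x (v 0) (v' 0)"
  using DERIV_nonpos_imp_nonincreasing[OF \<open>0 \<le> t\<close>, of "\<lambda>t. exp (x * t) * osc_form \<theta> k x (v t) (v' t)"]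
    osc_form_deriv[OF assms(1,2)] by (force simp: zero_le_mult_iff)

text \<open>The bound depends on \<open>k\<close> only through the coefficients of the form. This makes it uniform over the spectrum.\<close>

lemma exp_sq_le:
  assumes "x < \<theta>" "disc \<theta> k x > 0" "0 \<le> t"
  shows "exp (x * t) * (v t)\<^sup>2 \<le> 2 * (\<theta> - x) * osc_form \<theta> k x (v 0) (v' 0)"
proof -
  have "exp (x * t) * ((v t)\<^sup>2 / (2 * (\<theta> - x))) \<le> exp (x * t) * osc_form \<theta> k x (v t) (v' t)"
    using osc_form_ge_sq1[OF assms(1,2)] by (intro mult_left_mono) auto
  also have "\<dots> \<le> osc_form \<theta> k x (v 0) (v' 0)" by (rule osc_form_decreasing) fact+
  finally show ?thesis using assms by (simp add: field_simps)
qed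

text \<open>The range of \<open>x\<close> with a positive definite form is open, so the form for a slightly larger \<open>x'\<close> bounds \<open>v\<^sup>2\<close> and \<open>v'\<^sup>2\<close> by a multiple
of \<open>exp (- x' * t)\<close>, which beats the weight \<open>exp (x * t)\<close>.\<close>

lemma osc_form_tendsto_0:
  assumes "x < \<theta>" "disc \<theta> k x > 0"
  shows "((\<lambda>t. exp (x * t) * osc_form \<theta> k x (v t) (v' t)) \<longlongrightarrow> 0) at_top"
proof -
  have "((\<lambda>x'. disc \<theta> k x') \<longlongrightarrow> disc \<theta> k x) (at_right x)" unfolding disc_def
    by (intro tendsto_intros)
  then have "eventually (\<lambda>x'. disc \<theta> k x' > 0) (at_right x)"
    using assms order_tendstoD(1) by blast
  moreover have "eventually (\<lambda>x'. x' < \<theta>) (at_right x)" 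
    using assms eventually_at_right by blast
  moreover have "eventually (\<lambda>x'. x < x') (at_right x)" by (simp add: eventually_at_filter)
  ultimately obtain x' where x': "x < x'" "x' < \<theta>" "disc \<theta> k x' > 0"
    by (metis (mono_tags, lifting) eventually_conj eventually_happens trivial_limit_at_right_real)
  obtain c where c: "c > 0" "\<And>a b. c * b\<^sup>2 \<le> osc_form \<theta> k x' a b"
    using osc_form_ge_sq2[OF x'(2,3)] by blast
  define N where "N = osc_form \<theta> k x' (v 0) (v' 0)"
  define M where "M = max (2 * (\<theta> - x') * N) (N / c)"
  have *: "exp (x' * t) * (v t)\<^sup>2 \<le> M" "exp (x' * t) * (v' t)\<^sup>2 \<le> M" if "t \<ge> 0" for t
  proof -
    show "exp (x' * t) * (v t)\<^sup>2 \<le> M" using exp_sq_le[OF x'(2,3) that] by (simp add: M_def N_def)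
    have "exp (x' * t) * (c * (v' t)\<^sup>2) \<le> exp (x' * t) * osc_form \<theta> k x' (v t) (v' t)"
      using c by (intro mult_left_mono) auto
    also have "\<dots> \<le> N" using osc_form_decreasing[OF x'(2,3) that] by (simp add: N_def)
    finally have "exp (x' * t) * (v' t)\<^sup>2 \<le> N / c" using c by (simp add: field_simps)
    then show "exp (x' * t) * (v' t)\<^sup>2 \<le> M" by (simp add: M_def)
  qed
  have lim: "((\<lambda>t. M * exp (- (x' - x) * t)) \<longlongrightarrow> 0) at_top" 
    using x' by real_asymp
  have conv: "exp (x * t) * s \<le> M * exp (- (x' - x) * t)" if "exp (x' * t) * s \<le> M" for s t
  proof -
    have "exp (x * t) * s = (exp (x' * t) * s) * exp (- (x' - x) * t)"
      by (simp add: exp_add[symmetric] algebra_simps)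
    with that show ?thesis by (metis exp_ge_zero mult_right_mono)
  qed
  have l1: "((\<lambda>t. exp (x * t) * (v t)\<^sup>2) \<longlongrightarrow> 0) at_top"
  proof (rule tendsto_sandwich[OF _ _ tendsto_const lim])
    show "eventually (\<lambda>t. exp (x * t) * (v t)\<^sup>2 \<le> M * exp (- (x' - x) * t)) at_top"
      using eventually_ge_at_top[of 0] 
      by eventually_elim (use * conv in blast)
  qed auto
  have l2: "((\<lambda>t. exp (x * t) * (v' t)\<^sup>2) \<longlongrightarrow> 0) at_top"
  proof (rule tendsto_sandwich[OF _ _ tendsto_const lim])
    show "eventually (\<lambda>t. exp (x * t) * (v' t)\<^sup>2 \<le> M * exp (- (x' - x) * t)) at_top"
      using eventually_ge_at_top[of 0] 
      by eventually_elim (use * conv in blast)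
  qed auto
  have l3: "((\<lambda>t. exp (x * t) * (v t * v' t)) \<longlongrightarrow> 0) at_top"
  proof (rule Lim_null_comparison[OF _ tendsto_add_zero[OF l1 l2]], intro always_eventually allI)
    fix t
    have "\<bar>v t * v' t\<bar> \<le> (v t)\<^sup>2 + (v' t)\<^sup>2"
      using sum_squares_bound[of "v t" "v' t"] sum_squares_bound[of "v t" "- v' t"]
        zero_le_power2[of "v t"] zero_le_power2[of "v' t"] unfolding abs_le_iff power2_minus
      by linarith
    then show "norm (exp (x * t) * (v t * v' t)) \<le> exp (x * t) * (v t)\<^sup>2 + exp (x * t) * (v' t)\<^sup>2"
      by (simp add: abs_mult distrib_left[symmetric])
  qed
  have "((\<lambda>t. 2 / ((\<theta> - x) * disc \<theta> k x) * ((k + (\<theta> - x) * (2 * \<theta> - x) / 2) * (exp (x * t) * (v t)\<^sup>2) 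
      + (2 * \<theta> - x) * (exp (x * t) * (v t * v' t)) + exp (x * t) * (v' t)\<^sup>2)) \<longlongrightarrow> 
      2 / ((\<theta> - x) * disc \<theta> k x) * ((k + (\<theta> - x) * (2 * \<theta> - x) / 2) * 0 + (2 * \<theta> - x) * 0 + 0)) at_top"
    by (intro tendsto_intros l1 l2 l3)
  then show ?thesis by (simp add: osc_form_def algebra_simps)
qed

lemma nn_integral_exp_sq:
  assumes "x < \<theta>" "disc \<theta> k x > 0"
  shows "(\<integral>\<^sup>+t. ennreal (exp (x * t) * (v t)\<^sup>2) * indicator {0..} t \<partial>lborel)
          = ennreal (osc_form \<theta> k x (v 0) (v' 0))"
proof -
  have "continuous_on UNIV v" using v by (meson DERIV_continuous_on has_field_derivative_at_within)
  then have [measurable]: "v \<in> borel_measurable borel" by (rule borel_measurable_continuous_onI)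
  have "(\<integral>\<^sup>+t. ennreal (exp (x * t) * (v t)\<^sup>2) * indicator {0..} t \<partial>lborel)
      = ennreal (0 - (- (exp (x * 0) * osc_form \<theta> k x (v 0) (v' 0))))"
  proof (rule nn_integral_FTC_atLeast)
    show "((\<lambda>t. - (exp (x * t) * osc_form \<theta> k x (v t) (v' t))) has_real_derivative exp (x * t) * (v t)\<^sup>2) (at t)" for t
      using DERIV_minus[OF osc_form_deriv[OF assms]] by simp
    show "((\<lambda>t. - (exp (x * t) * osc_form \<theta> k x (v t) (v' t))) \<longlongrightarrow> 0) at_top"
      using tendsto_minus[OF osc_form_tendsto_0[OF assms]] by simp
  qed auto
  then show ?thesis by simp
qed

end

lemma damped_oscillator_y: "damped_oscillator \<theta> k (osc_y \<theta> k) (\<lambda>t. osc_u \<theta> k t - \<theta> * osc_y \<theta> k t)"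
proof
  fix t
  show "((\<lambda>t. osc_u \<theta> k t - \<theta> * osc_y \<theta> k t) has_real_derivative
      - \<theta> * (osc_u \<theta> k t - \<theta> * osc_y \<theta> k t) - k * osc_y \<theta> k t) (at t)"
    by (rule derivative_eq_intros osc_y_deriv osc_u_deriv refl)+ (simp add: algebra_simps)
qed (rule osc_y_deriv)

lemma damped_oscillator_u: "damped_oscillator \<theta> k (osc_u \<theta> k) (\<lambda>t. - k * osc_y \<theta> k t)"
proof
  fix t
  show "((\<lambda>t. - k * osc_y \<theta> k t) has_real_derivative
      - \<theta> * (- k * osc_y \<theta> k t) - k * osc_u \<theta> k t) (at t)"
    by (rule derivative_eq_intros osc_y_deriv osc_u_deriv refl)+ (simp add: algebra_simps)
qed (rule osc_u_deriv)

section \<open>The kernel functions as squares of oscillator solutions\<close>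

text \<open>Continuity of \<open>sn\<close> and \<open>cs\<close> at \<open>w = 0\<close> settles the critically damped case, where \<open>K\<close> and \<open>G\<close> are defined as limits.\<close>

lemma sn_tendsto: "((\<lambda>w. sn w t) \<longlongrightarrow> t) (at 0)"
proof -
  have "((\<lambda>x. sinh (x * t)) has_real_derivative t) (at 0)"
    by (auto intro!: derivative_eq_intros)
  then have sinh: "((\<lambda>x. sinh (x * t) / x) \<longlongrightarrow> t) (at 0)"
    by (simp add: DERIV_def)
  have "((\<lambda>x. sin (x * t)) has_real_derivative t) (at 0)"
    by (auto intro!: derivative_eq_intros)
  then have sin: "((\<lambda>x. sin (x * t) / x) \<longlongrightarrow> t) (at 0)"
    by (simp add: DERIV_def)
  have 1: "filterlim sqrt (at 0) (at_right 0)" and 2: "filterlim (\<lambda>w. sqrt (- w)) (at 0) (at_left 0)"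
    by (auto simp: filterlim_at eventually_at_filter intro!: tendsto_eq_intros always_eventually)
  have "((\<lambda>w. sn w t) \<longlongrightarrow> t) (at_right 0)"
    using filterlim_compose[OF sinh 1]
    by (rule Lim_transform_eventually) (auto simp: sn_def eventually_at_filter)
  moreover have "((\<lambda>w. sn w t) \<longlongrightarrow> t) (at_left 0)"
    using filterlim_compose[OF sin 2]
    by (rule Lim_transform_eventually) (auto simp: sn_def eventually_at_filter)
  ultimately show ?thesis by (simp add: filterlim_at_split)
qed

lemma cs_tendsto: "((\<lambda>w. cs w t) \<longlongrightarrow> 1) (at 0)"
proof -
  have 1: "((\<lambda>w. cosh (sqrt w * t)) \<longlongrightarrow> 1) (at_right 0)" and 2: "((\<lambda>w. cos (sqrt (- w) * t)) \<longlongrightarrow> 1) (at_left 0)"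
    by (auto intro!: tendsto_eq_intros)
  have "((\<lambda>w. cs w t) \<longlongrightarrow> 1) (at_right 0)"
    using 1 by (rule Lim_transform_eventually) (auto simp: cs_def eventually_at_filter)
  moreover have "((\<lambda>w. cs w t) \<longlongrightarrow> 1) (at_left 0)"
    using 2 by (rule Lim_transform_eventually) (auto simp: cs_def eventually_at_filter)
  ultimately show ?thesis by (simp add: filterlim_at_split)
qed

lemma omega_cases:
  assumes "omega \<gamma> \<theta> l \<noteq> 0"
  obtains r where "r > 0" "omega \<gamma> \<theta> l = (2 * r)\<^sup>2" "\<theta>\<^sup>2 / 4 - \<gamma> * l = - (r\<^sup>2)"
        | r where "r > 0" "omega \<gamma> \<theta> l = - ((2 * r)\<^sup>2)" "\<theta>\<^sup>2 / 4 - \<gamma> * l = r\<^sup>2"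
proof -
  define r where "r = sqrt \<bar>omega \<gamma> \<theta> l\<bar> / 2"
  have r: "r > 0" "(2 * r)\<^sup>2 = \<bar>omega \<gamma> \<theta> l\<bar>" using assms by (auto simp: r_def)
  have "\<theta>\<^sup>2 / 4 - \<gamma> * l = - omega \<gamma> \<theta> l / 4" by (simp add: omega_def)
  with r that[of r] show ?thesis by (cases "omega \<gamma> \<theta> l > 0") (auto simp: power2_eq_square)
qed

lemma csqrt_pos_square: "r > 0 \<Longrightarrow> csqrt (complex_of_real ((2 * r)\<^sup>2)) = complex_of_real (2 * r)"
  by (subst csqrt_of_real) (simp_all only: real_sqrt_abs zero_le_power2, simp)

lemma csqrt_neg_square: "r > 0 \<Longrightarrow> csqrt (complex_of_real (- ((2 * r)\<^sup>2))) = \<i> * complex_of_real (2 * r)"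
  by (subst csqrt_of_real') (simp only: real_sqrt_abs abs_minus_cancel abs_power2, simp)

lemma cos_imag: "cos (complex_of_real t * (\<i> * complex_of_real r)) = complex_of_real (cosh (t * r))"
  and sin_imag: "sin (complex_of_real t * (\<i> * complex_of_real r)) = \<i> * complex_of_real (sinh (t * r))"
proof -
  have *: "complex_of_real t * (\<i> * complex_of_real r) = \<i> * complex_of_real (t * r)" by simp
  show "cos (complex_of_real t * (\<i> * complex_of_real r)) = complex_of_real (cosh (t * r))"
    unfolding * cosh_conv_cos[symmetric] cosh_def by (simp add: exp_of_real scaleR_conv_of_real flip: of_real_minus of_real_mult)
  have "\<i> * sinh (complex_of_real (t * r)) = sin (\<i> * complex_of_real (t * r))"
    unfolding sinh_conv_sin by (simp add: algebra_simps)
  moreover have "sinh (complex_of_real (t * r)) = complex_of_real (sinh (t * r))"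
    unfolding sinh_def by (simp add: exp_of_real scaleR_conv_of_real flip: of_real_minus of_real_mult)
  ultimately show "sin (complex_of_real t * (\<i> * complex_of_real r)) = \<i> * complex_of_real (sinh (t * r))"
    unfolding * by simp
qed

text \<open>By \<open>1 - cos (2 * r * t) = 2 * (sin (r * t))\<^sup>2\<close> and its hyperbolic counterpart, with \<open>omega = \<plusminus> (2 * r)\<^sup>2\<close>.\<close>

lemma K_formula_eq:
  assumes "omega \<gamma> \<theta> l \<noteq> 0"
  shows "K_formula \<gamma> \<theta> t l = \<gamma>\<^sup>2 * l\<^sup>2 * (osc_y \<theta> (\<gamma> * l) t)\<^sup>2"
proof -
  have e: "(exp (- (\<theta> / 2) * t))\<^sup>2 = exp (- (t * \<theta>))"
    by (simp add: power2_eq_square flip: exp_add)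
  from assms show ?thesis
  proof (cases rule: omega_cases)
    case (1 r)
    have c: "1 - cos (t * (2 * r)) = 2 * (sin (r * t))\<^sup>2"
      using cos_double_sin[of "r * t"] by (simp add: mult_ac)
    have "K_formula \<gamma> \<theta> t l = 2 * (\<gamma>\<^sup>2 * l\<^sup>2) / (2 * r)\<^sup>2 * exp (- (t * \<theta>)) * (1 - cos (t * (2 * r)))"
      unfolding K_formula_def Let_def 1(2) csqrt_pos_square[OF 1(1)]
      by (subst Re_complex_of_real[symmetric])
        (simp only: of_real_mult of_real_minus exp_of_real[symmetric] cos_of_real[symmetric] sin_of_real[symmetric]
           of_real_1 of_real_diff of_real_add of_real_divide of_real_numeral of_real_power)
    then show ?thesis using 1(1) unfolding c osc_y_def 1(3) power_mult_distrib e
      by (simp add: sn_def power_divide)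
  next
    case (2 r)
    have c: "1 - cosh (t * (2 * r)) = - 2 * (sinh (r * t))\<^sup>2"
      using cosh_double[of "r * t"] by (simp add: mult_ac cosh_square_eq)
    have "K_formula \<gamma> \<theta> t l = 2 * (\<gamma>\<^sup>2 * l\<^sup>2) / (- ((2 * r)\<^sup>2)) * exp (- (t * \<theta>)) * (1 - cosh (t * (2 * r)))"
      unfolding K_formula_def Let_def 2(2) csqrt_neg_square[OF 2(1)] cos_imag
      by (subst Re_complex_of_real[symmetric])
        (simp only: of_real_mult of_real_minus exp_of_real[symmetric] cos_of_real[symmetric] sin_of_real[symmetric]
           of_real_1 of_real_diff of_real_add of_real_divide of_real_numeral of_real_power)
    then show ?thesis using 2(1) unfolding c osc_y_def 2(3) power_mult_distrib e
      by (simp add: sn_def power_divide)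
  qed
qed

lemma G_prefactor:
  fixes e c s d T W :: real
  assumes "W \<noteq> 0" "T + W \<noteq> 0"
  shows "1 / 4 * (1 + T / W) * e * (1 - (c * ((T - W) / (T + W)) - s * (d / (T + W))))
    = e * (1 / (4 * W) * ((T + W) - (c * (T - W) - s * d)))"
proof -
  have "1 + T / W = (T + W) / W" using assms by (simp add: field_simps)
  moreover have "1 - (c * ((T - W) / (T + W)) - s * (d / (T + W))) = ((T + W) - (c * (T - W) - s * d)) / (T + W)"
    using assms(2) by (simp add: diff_divide_distrib right_diff_distrib)
  ultimately show ?thesis using assms by simp
qed

text \<open>The phase is chosen such that the bracket in \<open>G\<close> is a perfect square: with \<open>omega = (2 * r)\<^sup>2\<close>, it is proportional to
\<open>(2 * r * cos (r * t) + \<theta> * sin (r * t))\<^sup>2\<close>.\<close>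

lemma G_formula_eq:
  assumes "omega \<gamma> \<theta> l \<noteq> 0" "\<gamma> * l \<noteq> 0"
  shows "G_formula \<gamma> \<theta> t l = (osc_u \<theta> (\<gamma> * l) t)\<^sup>2 / 2"
proof -
  have e: "(exp (- (\<theta> / 2) * t))\<^sup>2 = exp (- t * \<theta>)"
    by (simp add: power2_eq_square flip: exp_add)
  from assms(1) show ?thesis
  proof (cases rule: omega_cases)
    case (1 r)
    define S where "S = \<theta>\<^sup>2 + (2 * r)\<^sup>2"
    have "S = 4 * (\<gamma> * l)" using 1 by (simp add: S_def omega_def)
    then have S: "S \<noteq> 0" using assms by simp
    have c: "cos (t * (2 * r)) = (cos (r * t))\<^sup>2 - (sin (r * t))\<^sup>2" "sin (t * (2 * r)) = 2 * sin (r * t) * cos (r * t)"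
      using cos_double[of "r * t"] sin_double[of "r * t"] by (simp_all add: mult_ac)
    have "G_formula \<gamma> \<theta> t l = 1 / 4 * (1 + \<theta>\<^sup>2 / (2 * r)\<^sup>2) * exp (- t * \<theta>) *
        (1 - (cos (t * (2 * r)) * ((\<theta>\<^sup>2 - (2 * r)\<^sup>2) / S) - sin (t * (2 * r)) * (2 * \<theta> * (2 * r) / S)))"
      unfolding G_formula_def Let_def 1(2) csqrt_pos_square[OF 1(1)] S_def
      by (subst Re_complex_of_real[symmetric])
        (simp only: of_real_mult of_real_minus exp_of_real[symmetric] cos_of_real[symmetric] sin_of_real[symmetric]
           of_real_1 of_real_diff of_real_add of_real_divide of_real_numeral of_real_power)
    also have "\<dots> = exp (- t * \<theta>) * (1 / (4 * (2 * r)\<^sup>2) * (S - (cos (t * (2 * r)) * (\<theta>\<^sup>2 - (2 * r)\<^sup>2) - sin (t * (2 * r)) * (2 * \<theta> * (2 * r)))))"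
      using S 1(1) unfolding S_def by (intro G_prefactor) auto
    also have "S - (cos (t * (2 * r)) * (\<theta>\<^sup>2 - (2 * r)\<^sup>2) - sin (t * (2 * r)) * (2 * \<theta> * (2 * r)))
       = 2 * (2 * r * cos (r * t) + \<theta> * sin (r * t))\<^sup>2"
      unfolding c S_def sin_squared_eq by (simp add: algebra_simps power2_eq_square sin_squared_eq[unfolded power2_eq_square])
    also have "exp (- t * \<theta>) * (1 / (4 * (2 * r)\<^sup>2) * (2 * (2 * r * cos (r * t) + \<theta> * sin (r * t))\<^sup>2)) = (osc_u \<theta> (\<gamma> * l) t)\<^sup>2 / 2"
      using 1(1) unfolding osc_u_def 1(3) power_mult_distrib e
      by (simp add: sn_def cs_def power2_eq_square field_simps)
    finally show ?thesis .
  next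
    case (2 r)
    define S where "S = \<theta>\<^sup>2 + (- ((2 * r)\<^sup>2))"
    have "S = 4 * (\<gamma> * l)" using 2 by (simp add: S_def omega_def)
    then have S: "S \<noteq> 0" using assms by simp
    have c: "cosh (t * (2 * r)) = (cosh (r * t))\<^sup>2 + (sinh (r * t))\<^sup>2" "sinh (t * (2 * r)) = 2 * sinh (r * t) * cosh (r * t)"
      using cosh_double[of "r * t"] sinh_double[of "r * t"] by (simp_all add: mult_ac)
    have i: "\<i> * a * (2 * b * (\<i> * c) / d) = - (a * (2 * b * c / d))" for a b c d :: complex
      by (simp add: field_simps flip: power2_eq_square)
    have "G_formula \<gamma> \<theta> t l = 1 / 4 * (1 + \<theta>\<^sup>2 / (- ((2 * r)\<^sup>2))) * exp (- t * \<theta>) *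
        (1 - (cosh (t * (2 * r)) * ((\<theta>\<^sup>2 - (- ((2 * r)\<^sup>2))) / S) - (- sinh (t * (2 * r))) * ((2 * \<theta> * (2 * r)) / S)))"
      unfolding G_formula_def Let_def 2(2) csqrt_neg_square[OF 2(1)] cos_imag sin_imag S_def i
      by (subst Re_complex_of_real[symmetric])
        (simp only: of_real_mult of_real_minus exp_of_real[symmetric] cos_of_real[symmetric] sin_of_real[symmetric]
           of_real_1 of_real_diff of_real_add of_real_divide of_real_numeral of_real_power mult_minus_left)
    also have "\<dots> = exp (- t * \<theta>) * (1 / (4 * (- ((2 * r)\<^sup>2))) * (S - (cosh (t * (2 * r)) * (\<theta>\<^sup>2 - (- ((2 * r)\<^sup>2))) - (- sinh (t * (2 * r))) * (2 * \<theta> * (2 * r)))))"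
      using S 2(1) unfolding S_def by (intro G_prefactor) auto
    also have "S - (cosh (t * (2 * r)) * (\<theta>\<^sup>2 - (- ((2 * r)\<^sup>2))) - (- sinh (t * (2 * r))) * (2 * \<theta> * (2 * r)))
       = - (2 * (2 * r * cosh (r * t) + \<theta> * sinh (r * t))\<^sup>2)"
      unfolding c S_def cosh_square_eq by (simp add: algebra_simps power2_eq_square cosh_square_eq[unfolded power2_eq_square])
    also have "exp (- t * \<theta>) * (1 / (4 * (- ((2 * r)\<^sup>2))) * (- (2 * (2 * r * cosh (r * t) + \<theta> * sinh (r * t))\<^sup>2))) = (osc_u \<theta> (\<gamma> * l) t)\<^sup>2 / 2"
      using 2(1) unfolding osc_u_def 2(3) power_mult_distrib e
      by (simp add: sn_def cs_def power2_eq_square field_simps)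
    finally show ?thesis .
  qed
qed

lemma
  assumes "\<gamma> > 0" "\<theta> > 0"
  shows K_eq: "K \<gamma> \<theta> t l = \<gamma>\<^sup>2 * l\<^sup>2 * (osc_y \<theta> (\<gamma> * l) t)\<^sup>2" (is ?K)
    and G_eq: "l \<noteq> 0 \<Longrightarrow> G \<gamma> \<theta> t l = (osc_u \<theta> (\<gamma> * l) t)\<^sup>2 / 2"
proof -
  have *: "?K \<and> (l \<noteq> 0 \<longrightarrow> G \<gamma> \<theta> t l = (osc_u \<theta> (\<gamma> * l) t)\<^sup>2 / 2)"
  proof (cases "omega \<gamma> \<theta> l = 0")
    case False
    then show ?thesis using assms by (auto simp: K_def G_def K_formula_eq G_formula_eq)
  next
    case True
    then have l: "l = \<theta>\<^sup>2 / (4 * \<gamma>)" using assms by (simp add: omega_def field_simps)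
    with assms have "l > 0" by simp
    have ne: "omega \<gamma> \<theta> l' \<noteq> 0" if "l' \<noteq> l" for l'
      using that True assms by (auto simp: omega_def l field_simps)
    have fl: "filterlim (\<lambda>l'. \<theta>\<^sup>2 / 4 - \<gamma> * l') (at 0) (at l)"
      using assms by (auto simp: filterlim_at eventually_at_filter l field_simps
          intro!: tendsto_eq_intros always_eventually)
    note sn = filterlim_compose[OF sn_tendsto fl] and cs = filterlim_compose[OF cs_tendsto fl]
    have z: "\<theta>\<^sup>2 / 4 - \<gamma> * l = 0" using assms by (simp add: l)
    have "((\<lambda>l'. \<gamma>\<^sup>2 * l'\<^sup>2 * (osc_y \<theta> (\<gamma> * l') t)\<^sup>2) \<longlongrightarrow> \<gamma>\<^sup>2 * l\<^sup>2 * (osc_y \<theta> (\<gamma> * l) t)\<^sup>2) (at l)"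
      unfolding osc_y_def by (intro tendsto_intros tendsto_eq_rhs[OF sn]) (simp add: z sn_def)
    then have "(K_formula \<gamma> \<theta> t \<longlongrightarrow> \<gamma>\<^sup>2 * l\<^sup>2 * (osc_y \<theta> (\<gamma> * l) t)\<^sup>2) (at l)"
      by (rule Lim_transform_eventually) (auto simp: eventually_at_filter K_formula_eq ne)
    moreover
    have "((\<lambda>l'. (osc_u \<theta> (\<gamma> * l') t)\<^sup>2 / 2) \<longlongrightarrow> (osc_u \<theta> (\<gamma> * l) t)\<^sup>2 / 2) (at l)"
      unfolding osc_u_def by (intro tendsto_intros tendsto_eq_rhs[OF sn] tendsto_eq_rhs[OF cs])
        (simp_all add: z sn_def cs_def)
    moreover have "eventually (\<lambda>l'. l' > 0) (at l)"
      using \<open>l > 0\<close> by (rule order_tendstoD(1)[OF tendsto_ident_at])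
    then have "eventually (\<lambda>l'. (osc_u \<theta> (\<gamma> * l') t)\<^sup>2 / 2 = G_formula \<gamma> \<theta> t l') (at l)"
      unfolding eventually_at_filter by eventually_elim (use assms in \<open>auto simp: G_formula_eq ne\<close>)
    ultimately have "(K_formula \<gamma> \<theta> t \<longlongrightarrow> \<gamma>\<^sup>2 * l\<^sup>2 * (osc_y \<theta> (\<gamma> * l) t)\<^sup>2) (at l)"
      "(G_formula \<gamma> \<theta> t \<longlongrightarrow> (osc_u \<theta> (\<gamma> * l) t)\<^sup>2 / 2) (at l)"
      by (auto intro: Lim_transform_eventually)
    then show ?thesis using True by (auto simp: K_def G_def tendsto_Lim)
  qed
  then show ?K and "l \<noteq> 0 \<Longrightarrow> G \<gamma> \<theta> t l = (osc_u \<theta> (\<gamma> * l) t)\<^sup>2 / 2" by blast+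
qed

section \<open>The spectral measure\<close>

text \<open>The complement of the support is the union of all open null sets; by the Lindelof property countably many of them suffice.\<close>

lemma AE_in_msupport:
  assumes sets: "sets \<mu> = sets borel"
  shows "AE x in \<mu>. x \<in> msupport \<mu>"
proof -
  let ?F = "{U. open U \<and> emeasure \<mu> U = 0}"
  obtain F' where F': "F' \<subseteq> ?F" "countable F'" "\<Union>F' = \<Union>?F"
    using Lindelof[of ?F] by auto
  have "\<Union>F' \<in> null_sets \<mu>"
    by (rule null_sets_UN'[where N = "\<lambda>x. x" and I = F', simplified]) (use F' sets in \<open>auto simp: null_sets_def\<close>)
  then have "AE x in \<mu>. x \<notin> \<Union>F'" by (rule AE_not_in)
  then show ?thesis
    by eventually_elim (auto simp: F'(3) msupport_def zero_less_iff_neq_zero)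
qed

locale sdahb =
  fixes \<mu> :: "real measure" and lm lp ell \<alpha> \<gamma> \<theta> R R' :: real
  assumes spec: "spectral_measure \<mu> lm lp ell \<alpha>"
    and gamma: "\<gamma> > 0" and theta: "\<theta> > 0" and R: "R \<ge> 0" and R': "R' \<ge> 0"
begin

sublocale prob_space \<mu>
  using spec by (simp add: spectral_measure_def)

lemma sets_mu [measurable_cong]: "sets \<mu> = sets borel"
  using spec by (simp add: spectral_measure_def)

lemma space_mu [simp]: "space \<mu> = UNIV"
  using sets_mu by (metis sets_eq_imp_space_eq space_borel)

lemma lm: "0 < lm" "lm \<le> lp"
  using spec by (simp_all add: spectral_measure_def)

lemma msupport_mu: "msupport \<mu> = {0} \<union> {lm..lp}"
  using spec by (simp add: spectral_measure_def)

lemma AE_support: "AE l in \<mu>. l = 0 \<or> lm \<le> l \<and> l \<le> lp"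
  using AE_in_msupport[OF sets_mu] by (simp add: msupport_mu)

lemma measure_near_lm:
  assumes "\<epsilon> > 0"
  shows "measure \<mu> {lm..<lm + \<epsilon>} > 0"
proof -
  have "lm \<in> msupport \<mu>" using lm by (simp add: msupport_mu)
  then have "0 < emeasure \<mu> {lm / 2<..<lm + \<epsilon>}"
    using lm assms unfolding msupport_def by simp
  also have "emeasure \<mu> {lm / 2<..<lm + \<epsilon>} = emeasure \<mu> {lm..<lm + \<epsilon>}"
    by (rule emeasure_eq_AE) (use AE_support lm in auto)
  finally show ?thesis by (simp add: emeasure_eq_measure)
qed

lemma integrable_id: "integrable \<mu> (\<lambda>l. l)"
  by (rule integrable_const_bound[where B = lp]) (use AE_support lm in auto)

lemma set_integral_mu:
  fixes f :: "real \<Rightarrow> real"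
  assumes [measurable]: "f \<in> borel_measurable borel"
  shows "(LINT l:{0..}|\<mu>. f l) = (\<integral>l. f l \<partial>\<mu>)"
  unfolding set_lebesgue_integral_def
  by (rule integral_cong_AE) (use AE_support lm in auto)

lemma tr_eq: "tr \<mu> = (\<integral>l. l \<partial>\<mu>)"
  unfolding tr_def by (rule set_integral_mu) simp

lemma tr_pos: "tr \<mu> > 0"
proof -
  have "0 < lm * measure \<mu> {lm..<lm + 1}" using measure_near_lm[of 1] lm by simp
  also have "\<dots> = (\<integral>l. lm * indicator {lm..<lm + 1} l \<partial>\<mu>)" by simp
  also have "\<dots> \<le> tr \<mu>" unfolding tr_eq
    by (intro integral_mono_AE integrable_id integrable_mult_right integrable_real_indicator)
      (use AE_support lm in \<open>auto simp: emeasure_eq_measure indicator_def\<close>)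
  finally show ?thesis .
qed

text \<open>The condition of convergence for the smallest positive eigenvalue. It implies the one for all larger eigenvalues.\<close>

definition admissible :: "real \<Rightarrow> bool" where
  "admissible x \<longleftrightarrow> x < \<theta> \<and> disc \<theta> (\<gamma> * lm) x > 0"

lemma admissible_0: "admissible 0"
  using lm gamma theta by (simp add: admissible_def disc_def)

lemma admissible_disc:
  assumes "admissible x" "lm \<le> l"
  shows "disc \<theta> (\<gamma> * l) x \<ge> disc \<theta> (\<gamma> * lm) x" "disc \<theta> (\<gamma> * l) x > 0"
proof -
  have "\<gamma> * lm \<le> \<gamma> * l" using assms gamma by simp
  then show *: "disc \<theta> (\<gamma> * l) x \<ge> disc \<theta> (\<gamma> * lm) x" by (simp add: disc_def)
  show "disc \<theta> (\<gamma> * l) x > 0" using * assms by (simp add: admissible_def)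
qed

section \<open>Laplace transform of the kernel\<close>

lemma measurable_osc_y [measurable]:
  assumes [measurable]: "f \<in> borel_measurable M" "g \<in> borel_measurable M"
  shows "(\<lambda>x. osc_y \<theta> (f x) (g x)) \<in> borel_measurable M"
  unfolding osc_y_def using measurable_compose[OF _ measurable_sn, of "\<lambda>x. (g x, \<theta>\<^sup>2 / 4 - f x)" M] by simp

lemma measurable_osc_u [measurable]:
  assumes [measurable]: "f \<in> borel_measurable M" "g \<in> borel_measurable M"
  shows "(\<lambda>x. osc_u \<theta> (f x) (g x)) \<in> borel_measurable M"
  unfolding osc_u_def using measurable_compose[OF _ measurable_sn, of "\<lambda>x. (g x, \<theta>\<^sup>2 / 4 - f x)" M] 
    measurable_compose[OF _ measurable_cs, of "\<lambda>x. (g x, \<theta>\<^sup>2 / 4 - f x)" M] by simp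

lemma measurable_K [measurable]:
  assumes [measurable]: "f \<in> borel_measurable M" "g \<in> borel_measurable M"
  shows "(\<lambda>x. K \<gamma> \<theta> (f x) (g x)) \<in> borel_measurable M"
  unfolding K_eq[OF gamma theta] by measurable

lemma K_nonneg: "K \<gamma> \<theta> t l \<ge> 0"
  by (simp add: K_eq[OF gamma theta])

lemma K_le:
  assumes "l \<ge> 0" "t \<ge> 0"
  shows "K \<gamma> \<theta> t l \<le> \<gamma> * l"
proof (cases "l = 0")
  case False
  interpret damped_oscillator \<theta> "\<gamma> * l" "osc_y \<theta> (\<gamma> * l)" "\<lambda>t. osc_u \<theta> (\<gamma> * l) t - \<theta> * osc_y \<theta> (\<gamma> * l) t"
    by (rule damped_oscillator_y)
  have "(osc_y \<theta> (\<gamma> * l) t)\<^sup>2 \<le> 1 / (\<gamma> * l)"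
    using exp_sq_le[of 0 t] False assms gamma theta by (simp add: disc_def osc_form_def)
  then have "(\<gamma> * l) * (osc_y \<theta> (\<gamma> * l) t)\<^sup>2 \<le> 1"
    using False assms gamma by (simp add: field_simps)
  then have "(\<gamma> * l) * ((\<gamma> * l) * (osc_y \<theta> (\<gamma> * l) t)\<^sup>2) \<le> (\<gamma> * l) * 1"
    using assms gamma by (intro mult_left_mono) auto
  then show ?thesis unfolding K_eq[OF gamma theta] by (simp add: power2_eq_square mult_ac)
qed (simp add: K_eq[OF gamma theta])

lemma kernel_eq: "kernel \<mu> \<gamma> \<theta> t = (\<integral>l. K \<gamma> \<theta> t l \<partial>\<mu>)"
  unfolding kernel_def by (rule set_integral_mu) measurable

lemma measurable_kernel [measurable]: "kernel \<mu> \<gamma> \<theta> \<in> borel_measurable borel"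
  unfolding kernel_eq[abs_def] by measurable

lemma kernel_nonneg: "kernel \<mu> \<gamma> \<theta> t \<ge> 0"
  unfolding kernel_eq by (simp add: K_nonneg)

lemma integrable_K: "t \<ge> 0 \<Longrightarrow> integrable \<mu> (K \<gamma> \<theta> t)"
  by (rule integrable_const_bound[where B = "\<gamma> * lp"])
    (use AE_support lm gamma in \<open>auto elim!: eventually_mono intro!: order_trans[OF K_le] simp: K_nonneg\<close>)

lemma kernel_le: "t \<ge> 0 \<Longrightarrow> kernel \<mu> \<gamma> \<theta> t \<le> \<gamma> * tr \<mu>"
  unfolding kernel_eq tr_eq integral_mult_right_zero[symmetric]
  by (intro integral_mono_AE integrable_K integrable_mult_right integrable_id)
    (use AE_support lm in \<open>auto elim!: eventually_mono intro!: K_le\<close>)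

text \<open>Stated with values in \<open>[0, \<infinity>]\<close> and for every \<open>x\<close>, because it also serves to prove divergence.\<close>

lemma nn_kernel:
  "(\<integral>\<^sup>+t. ennreal (exp (x * t) * kernel \<mu> \<gamma> \<theta> t) * indicator {0..} t \<partial>lborel)
   = (\<integral>\<^sup>+l. ennreal (\<gamma>\<^sup>2 * l\<^sup>2) * (\<integral>\<^sup>+t. ennreal (exp (x * t) * (osc_y \<theta> (\<gamma> * l) t)\<^sup>2) * indicator {0..} t \<partial>lborel) \<partial>\<mu>)"
proof -
  interpret pair_sigma_finite lborel \<mu> ..
  have "(\<integral>\<^sup>+t. ennreal (exp (x * t) * kernel \<mu> \<gamma> \<theta> t) * indicator {0..} t \<partial>lborel)
    = (\<integral>\<^sup>+t. (\<integral>\<^sup>+l. ennreal (exp (x * t) * K \<gamma> \<theta> t l) * indicator {0..} t \<partial>\<mu>) \<partial>lborel)"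
  proof (rule nn_integral_cong)
    fix t
    show "ennreal (exp (x * t) * kernel \<mu> \<gamma> \<theta> t) * indicator {0..} t = (\<integral>\<^sup>+l. ennreal (exp (x * t) * K \<gamma> \<theta> t l) * indicator {0..} t \<partial>\<mu>)"
    proof (cases "t \<ge> 0")
      case True
      then show ?thesis using integrable_K[OF True] 
        by (simp add: kernel_eq nn_integral_eq_integral K_nonneg ennreal_mult nn_integral_cmult)
    qed simp
  qed
  also have "\<dots> = (\<integral>\<^sup>+l. (\<integral>\<^sup>+t. ennreal (exp (x * t) * K \<gamma> \<theta> t l) * indicator {0..} t \<partial>lborel) \<partial>\<mu>)"
    by (rule Fubini'[symmetric]) measurable
  also have "\<dots> = (\<integral>\<^sup>+l. ennreal (\<gamma>\<^sup>2 * l\<^sup>2) * (\<integral>\<^sup>+t. ennreal (exp (x * t) * (osc_y \<theta> (\<gamma> * l) t)\<^sup>2) * indicator {0..} t \<partial>lborel) \<partial>\<mu>)"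
    by (subst nn_integral_cmult[symmetric])
      (auto simp: K_eq[OF gamma theta] ennreal_mult' mult_ac intro!: nn_integral_cong)
  finally show ?thesis .
qed

definition kern_lap :: "real \<Rightarrow> real \<Rightarrow> real" where
  "kern_lap x l = 2 * \<gamma>\<^sup>2 * l\<^sup>2 / ((\<theta> - x) * disc \<theta> (\<gamma> * l) x)"

definition M :: "real \<Rightarrow> real" where "M x = (\<integral>l. kern_lap x l \<partial>\<mu>)"

lemma measurable_kern_lap [measurable]: "kern_lap x \<in> borel_measurable borel"
  unfolding kern_lap_def disc_def by measurable

lemma kern_lap_bounds:
  assumes "admissible x" "l = 0 \<or> lm \<le> l \<and> l \<le> lp"
  shows "0 \<le> kern_lap x l" "kern_lap x l \<le> 2 * \<gamma>\<^sup>2 * lp\<^sup>2 / ((\<theta> - x) * disc \<theta> (\<gamma> * lm) x)"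
proof -
  note d = admissible_disc[OF assms(1)] assms(1)[unfolded admissible_def]
  show "0 \<le> kern_lap x l"
    using assms(2) d by (cases "l = 0") (auto simp: kern_lap_def intro!: divide_nonneg_pos mult_pos_pos)
  show "kern_lap x l \<le> 2 * \<gamma>\<^sup>2 * lp\<^sup>2 / ((\<theta> - x) * disc \<theta> (\<gamma> * lm) x)"
  proof (cases "l = 0")
    case False
    with assms(2) have l: "lm \<le> l" "l \<le> lp" by auto
    have "l\<^sup>2 \<le> lp\<^sup>2" using l lm by (intro power_mono) auto
    then show ?thesis unfolding kern_lap_def using d(1)[OF l(1)] d
      by (intro frac_le mult_left_mono mult_pos_pos) auto
  qed (use d in \<open>auto simp: kern_lap_def intro!: divide_nonneg_pos mult_pos_pos\<close>)
qed

lemma integrable_kern_lap: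
  assumes "admissible x" shows "integrable \<mu> (kern_lap x)"
  by (rule integrable_const_bound[where B = "2 * \<gamma>\<^sup>2 * lp\<^sup>2 / ((\<theta> - x) * disc \<theta> (\<gamma> * lm) x)"])
    (use AE_support kern_lap_bounds[OF assms] in \<open>auto elim!: eventually_mono\<close>)

lemma M_nonneg: "admissible x \<Longrightarrow> 0 \<le> M x"
  unfolding M_def using AE_support kern_lap_bounds(1)
  by (intro integral_nonneg_AE) (auto elim!: eventually_mono)

lemma nn_kernel_good:
  assumes "admissible x"
  shows "(\<integral>\<^sup>+t. ennreal (exp (x * t) * kernel \<mu> \<gamma> \<theta> t) * indicator {0..} t \<partial>lborel) = ennreal (M x)"
proof -
  note d = admissible_disc[OF assms(1)] assms(1)[unfolded admissible_def]
  have "(\<integral>\<^sup>+t. ennreal (exp (x * t) * kernel \<mu> \<gamma> \<theta> t) * indicator {0..} t \<partial>lborel)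
      = (\<integral>\<^sup>+l. ennreal (kern_lap x l) \<partial>\<mu>)"
    unfolding nn_kernel
  proof (rule nn_integral_cong_AE)
    show "AE l in \<mu>. ennreal (\<gamma>\<^sup>2 * l\<^sup>2) * (\<integral>\<^sup>+t. ennreal (exp (x * t) * (osc_y \<theta> (\<gamma> * l) t)\<^sup>2) * indicator {0..} t \<partial>lborel)
        = ennreal (kern_lap x l)"
      using AE_support
    proof eventually_elim
      case (elim l)
      show ?case
      proof (cases "l = 0")
        case False
        with elim d have "disc \<theta> (\<gamma> * l) x > 0" "x < \<theta>" by auto
        then show ?thesis
          by (subst damped_oscillator.nn_integral_exp_sq[OF damped_oscillator_y])
            (simp_all add: osc_form_def kern_lap_def ennreal_mult'[symmetric] mult_ac)
      qed (simp add: kern_lap_def)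
    qed
  qed
  also have "\<dots> = ennreal (M x)" unfolding M_def
    using AE_support kern_lap_bounds(1)[OF assms]
    by (intro nn_integral_eq_integral integrable_kern_lap assms) (auto elim!: eventually_mono)
  finally show ?thesis .
qed

lemma
  assumes "admissible x"
  shows integrable_kernel: "integrable lborel (\<lambda>t. indicator {0..} t * (exp (x * t) * kernel \<mu> \<gamma> \<theta> t))"
    and integral_kernel: "(\<integral>t. indicator {0..} t * (exp (x * t) * kernel \<mu> \<gamma> \<theta> t) \<partial>lborel) = M x"
proof -
  have eq: "ennreal (indicator {0..} t * (exp (x * t) * kernel \<mu> \<gamma> \<theta> t))
      = ennreal (exp (x * t) * kernel \<mu> \<gamma> \<theta> t) * indicator {0..} t" for t
    by (auto simp: indicator_def)
  have "has_bochner_integral lborel (\<lambda>t. indicator {0..} t * (exp (x * t) * kernel \<mu> \<gamma> \<theta> t)) (M x)"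
    by (rule has_bochner_integral_nn_integral)
      (auto simp: eq nn_kernel_good[OF assms] M_nonneg[OF assms] kernel_nonneg)
  then show "integrable lborel (\<lambda>t. indicator {0..} t * (exp (x * t) * kernel \<mu> \<gamma> \<theta> t))"
    and "(\<integral>t. indicator {0..} t * (exp (x * t) * kernel \<mu> \<gamma> \<theta> t) \<partial>lborel) = M x"
    by (auto simp: has_bochner_integral_iff)
qed

lemma M_0: "M 0 = \<gamma> * tr \<mu> / (2 * \<theta>)"
proof -
  have "kern_lap 0 l = \<gamma> / (2 * \<theta>) * l" for l
    using gamma theta by (cases "l = 0") (simp_all add: kern_lap_def disc_def power2_eq_square)
  then show ?thesis by (simp add: M_def tr_eq)
qed

lemma kernel_norm_eq: "kernel_norm \<mu> \<gamma> \<theta> = M 0"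
  using integral_kernel[OF admissible_0] by (simp add: kernel_norm_def set_lebesgue_integral_def)


section \<open>Laplace transform of the forcing\<close>

text \<open>The contribution of a positive eigenvalue to the forcing. The eigenvalue \<open>0\<close> does not decay and contributes the limit \<open>Finf\<close>.\<close>

definition excess :: "real \<Rightarrow> real \<Rightarrow> real" where
  "excess t l = indicator {0<..} l * ((R * l + R') * (osc_u \<theta> (\<gamma> * l) t)\<^sup>2 / 2)"

definition Phi :: "real \<Rightarrow> real" where "Phi t = (\<integral>l. excess t l \<partial>\<mu>)"

definition Finf :: real where "Finf = R' / 2 * measure \<mu> {0}"

lemma measurable_excess [measurable]:
  assumes [measurable]: "f \<in> borel_measurable N" "g \<in> borel_measurable N"
  shows "(\<lambda>x. excess (f x) (g x)) \<in> borel_measurable N"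
  unfolding excess_def by measurable

lemma measurable_Phi [measurable]: "Phi \<in> borel_measurable borel"
  unfolding Phi_def by measurable

definition excess_bound :: "real \<Rightarrow> real" where
  "excess_bound x = 2 * (R * lp + R') / disc \<theta> (\<gamma> * lm) x * (\<gamma> * lp + (\<theta> - x) * (2 * \<theta> - x) / 2)"

lemma osc_form_10_bounds:
  assumes "admissible x" "lm \<le> l" "l \<le> lp"
  shows "0 \<le> osc_form \<theta> (\<gamma> * l) x 1 0"
    "(\<theta> - x) * ((R * l + R') * osc_form \<theta> (\<gamma> * l) x 1 0) \<le> excess_bound x"
proof -
  note d = admissible_disc[OF assms(1)] assms(1)[unfolded admissible_def]
  have pos: "(\<theta> - x) * (2 * \<theta> - x) \<ge> 0" using d theta by simp
  have l: "l > 0" "\<gamma> * l \<le> \<gamma> * lp" "0 \<le> \<gamma> * l" using assms lm gamma by auto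
  show "0 \<le> osc_form \<theta> (\<gamma> * l) x 1 0" unfolding osc_form_def
    using d(2)[OF assms(2)] d(3) l pos by (intro mult_nonneg_nonneg divide_nonneg_pos mult_pos_pos) auto
  have "(\<theta> - x) * ((R * l + R') * osc_form \<theta> (\<gamma> * l) x 1 0)
      = 2 * (R * l + R') / disc \<theta> (\<gamma> * l) x * (\<gamma> * l + (\<theta> - x) * (2 * \<theta> - x) / 2)"
  proof -
    have "(\<theta> - x) * (r * (2 / ((\<theta> - x) * D) * E)) = 2 * r / D * E" for r D E
      using d by simp
    moreover have "osc_form \<theta> (\<gamma> * l) x 1 0 = 2 / ((\<theta> - x) * disc \<theta> (\<gamma> * l) x) * (\<gamma> * l + (\<theta> - x) * (2 * \<theta> - x) / 2)"
      by (simp add: osc_form_def)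
    ultimately show ?thesis by (simp only:)
  qed
  also have "\<dots> \<le> excess_bound x" unfolding excess_bound_def
    using d assms l pos R R' gamma theta by (intro mult_mono frac_le mult_left_mono add_mono divide_nonneg_pos) auto
  finally show "(\<theta> - x) * ((R * l + R') * osc_form \<theta> (\<gamma> * l) x 1 0) \<le> excess_bound x" .
qed

lemma excess_nonneg: "0 \<le> l \<Longrightarrow> 0 \<le> excess t l"
  using R R' by (auto simp: excess_def indicator_def)

lemma excess_bound_nonneg: "admissible x \<Longrightarrow> 0 \<le> excess_bound x"
  using osc_form_10_bounds[of x lm] lm R R' by (smt (verit) admissible_def mult_nonneg_nonneg)

lemma exp_excess_le:
  assumes "admissible x" "l = 0 \<or> lm \<le> l \<and> l \<le> lp" "t \<ge> 0"
  shows "exp (x * t) * excess t l \<le> excess_bound x"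
proof (cases "l = 0")
  case True
  then show ?thesis using excess_bound_nonneg[OF assms(1)] by (simp add: excess_def)
next
  case False
  with assms have l: "lm \<le> l" "l \<le> lp" by auto
  interpret damped_oscillator \<theta> "\<gamma> * l" "osc_u \<theta> (\<gamma> * l)" "\<lambda>t. - (\<gamma> * l) * osc_y \<theta> (\<gamma> * l) t"
    by (rule damped_oscillator_u)
  have "exp (x * t) * (osc_u \<theta> (\<gamma> * l) t)\<^sup>2 \<le> 2 * (\<theta> - x) * osc_form \<theta> (\<gamma> * l) x 1 0"
    using exp_sq_le[of x t] admissible_disc[OF assms(1) l(1)] assms by (simp add: admissible_def)
  then have "(R * l + R') / 2 * (exp (x * t) * (osc_u \<theta> (\<gamma> * l) t)\<^sup>2) \<le> (R * l + R') / 2 * (2 * (\<theta> - x) * osc_form \<theta> (\<gamma> * l) x 1 0)"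
    using R R' l lm by (intro mult_left_mono) auto
  also have "\<dots> \<le> excess_bound x" using osc_form_10_bounds(2)[OF assms(1) l]
    by (rule order_trans[rotated]) (simp add: field_simps)
  finally show ?thesis using l lm by (simp add: excess_def mult_ac)
qed

lemma integrable_excess:
  assumes "t \<ge> 0" shows "integrable \<mu> (excess t)"
  by (rule integrable_const_bound[where B = "excess_bound 0"])
    (use AE_support exp_excess_le[OF admissible_0, of _ t] assms excess_nonneg[of _ t] lm in \<open>auto elim!: eventually_mono\<close>)

lemma Phi_nonneg: "0 \<le> Phi t"
  unfolding Phi_def using AE_support lm by (intro integral_nonneg_AE) (auto elim!: eventually_mono intro: excess_nonneg)

lemma exp_Phi_le:
  assumes "admissible x" "t \<ge> 0"
  shows "exp (x * t) * Phi t \<le> excess_bound x"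
proof -
  have "exp (x * t) * Phi t = (\<integral>l. exp (x * t) * excess t l \<partial>\<mu>)" by (simp add: Phi_def)
  also have "\<dots> \<le> (\<integral>l. excess_bound x \<partial>\<mu>)"
    using AE_support exp_excess_le[OF assms(1) _ assms(2)]
    by (intro integral_mono_AE integrable_mult_right integrable_excess assms) (auto elim!: eventually_mono)
  finally show ?thesis using prob_space by simp
qed

lemma forcing_eq:
  assumes "t \<ge> 0"
  shows "forcing \<mu> R R' \<gamma> \<theta> t = Finf + Phi t"
proof -
  have G: "G \<gamma> \<theta> t l = (if l = 0 then 1 / 2 else (osc_u \<theta> (\<gamma> * l) t)\<^sup>2 / 2)" for l
    using G_eq[OF gamma theta] by (simp add: G_def)
  have "forcing \<mu> R R' \<gamma> \<theta> t = (\<integral>l. (R * l + R') * G \<gamma> \<theta> t l \<partial>\<mu>)"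
    unfolding forcing_def by (rule set_integral_mu) (unfold G, measurable)
  also have "\<dots> = (\<integral>l. R' / 2 * indicator {0} l + excess t l \<partial>\<mu>)"
    unfolding G using AE_support lm
    by (intro integral_cong_AE) (auto simp: excess_def elim!: eventually_mono)
  also have "\<dots> = Finf + Phi t"
    unfolding Finf_def Phi_def
    by (subst Bochner_Integration.integral_add) (auto simp: emeasure_eq_measure intro!: integrable_excess assms)
  finally show ?thesis .
qed

definition excess_lap :: "real \<Rightarrow> real \<Rightarrow> real" where
  "excess_lap x l = indicator {0<..} l * ((R * l + R') / 2 * osc_form \<theta> (\<gamma> * l) x 1 0)"

lemma measurable_excess_lap [measurable]: "excess_lap x \<in> borel_measurable borel"
  unfolding excess_lap_def osc_form_def disc_def by measurable

lemma nn_Phi: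
  assumes "admissible x"
  shows "(\<integral>\<^sup>+t. ennreal (exp (x * t) * Phi t) * indicator {0..} t \<partial>lborel) = (\<integral>\<^sup>+l. ennreal (excess_lap x l) \<partial>\<mu>)"
proof -
  interpret pair_sigma_finite lborel \<mu> ..
  have "(\<integral>\<^sup>+t. ennreal (exp (x * t) * Phi t) * indicator {0..} t \<partial>lborel)
    = (\<integral>\<^sup>+t. (\<integral>\<^sup>+l. ennreal (exp (x * t) * excess t l) * indicator {0..} t \<partial>\<mu>) \<partial>lborel)"
  proof (rule nn_integral_cong)
    fix t
    show "ennreal (exp (x * t) * Phi t) * indicator {0..} t = (\<integral>\<^sup>+l. ennreal (exp (x * t) * excess t l) * indicator {0..} t \<partial>\<mu>)"
    proof (cases "t \<ge> 0")
      case True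
      have "(\<integral>\<^sup>+l. ennreal (exp (x * t) * excess t l) \<partial>\<mu>) = ennreal (\<integral>l. exp (x * t) * excess t l \<partial>\<mu>)"
        using AE_support lm 
        by (intro nn_integral_eq_integral integrable_mult_right integrable_excess True)
          (auto elim!: eventually_mono intro!: mult_nonneg_nonneg excess_nonneg)
      then show ?thesis using True by (simp add: Phi_def)
    qed simp
  qed
  also have "\<dots> = (\<integral>\<^sup>+l. (\<integral>\<^sup>+t. ennreal (exp (x * t) * excess t l) * indicator {0..} t \<partial>lborel) \<partial>\<mu>)"
    by (rule Fubini'[symmetric]) measurable
  also have "\<dots> = (\<integral>\<^sup>+l. ennreal (excess_lap x l) \<partial>\<mu>)"
  proof (rule nn_integral_cong_AE)
    show "AE l in \<mu>. (\<integral>\<^sup>+t. ennreal (exp (x * t) * excess t l) * indicator {0..} t \<partial>lborel) = ennreal (excess_lap x l)"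
      using AE_support
    proof eventually_elim
      case (elim l)
      show ?case
      proof (cases "l = 0")
        case False
        with elim lm have l: "lm \<le> l" "0 < l" by auto
        have Rl: "0 \<le> (R * l + R') / 2" using R R' l by simp
        have eq: "ennreal (exp (x * t) * excess t l) * indicator {0..} t =
            ennreal ((R * l + R') / 2) * (ennreal (exp (x * t) * (osc_u \<theta> (\<gamma> * l) t)\<^sup>2) * indicator {0..} t)" for t
          using l Rl by (subst mult.assoc[symmetric], subst ennreal_mult'[symmetric]) (auto simp: excess_def mult_ac)
        have "disc \<theta> (\<gamma> * l) x > 0" "x < \<theta>" using admissible_disc[OF assms l(1)] assms by (auto simp: admissible_def)
        then show ?thesis unfolding eq
          by (subst nn_integral_cmult, measurable, subst damped_oscillator.nn_integral_exp_sq[OF damped_oscillator_u])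
            (use l Rl in \<open>auto simp: excess_lap_def ennreal_mult'[symmetric]\<close>)
      qed (simp add: excess_def excess_lap_def)
    qed
  qed
  finally show ?thesis .
qed

lemma integrable_excess_lap:
  assumes "admissible x" shows "integrable \<mu> (excess_lap x)"
proof (rule integrable_const_bound[where B = "excess_bound x / (2 * (\<theta> - x))"])
  show "AE l in \<mu>. norm (excess_lap x l) \<le> excess_bound x / (2 * (\<theta> - x))"
    using AE_support
  proof eventually_elim
    case (elim l)
    have x: "\<theta> - x > 0" using assms by (simp add: admissible_def)
    show ?case
    proof (cases "l = 0")
      case False
      with elim have l: "lm \<le> l" "l \<le> lp" by auto
      from osc_form_10_bounds[OF assms l] x R R' l lm show ?thesis
        by (auto simp: excess_lap_def abs_mult field_simps)
    qed (use excess_bound_nonneg[OF assms] x in \<open>simp add: excess_lap_def\<close>)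
  qed
qed simp

lemma excess_lap_nonneg: "admissible x \<Longrightarrow> l = 0 \<or> lm \<le> l \<and> l \<le> lp \<Longrightarrow> 0 \<le> excess_lap x l"
  using osc_form_10_bounds(1)[of x l] R R' lm 
  by (cases "l = 0") (auto simp: excess_lap_def intro!: mult_nonneg_nonneg)

lemma
  assumes "admissible x"
  shows integrable_Phi: "integrable lborel (\<lambda>t. indicator {0..} t * (exp (x * t) * Phi t))"
    and integral_Phi: "(\<integral>t. indicator {0..} t * (exp (x * t) * Phi t) \<partial>lborel) = (\<integral>l. excess_lap x l \<partial>\<mu>)"
proof -
  have ae: "AE l in \<mu>. 0 \<le> excess_lap x l"
    using AE_support excess_lap_nonneg[OF assms] by (auto elim!: eventually_mono)
  have eq: "ennreal (indicator {0..} t * (exp (x * t) * Phi t))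
      = ennreal (exp (x * t) * Phi t) * indicator {0..} t" for t
    by (auto simp: indicator_def)
  have "has_bochner_integral lborel (\<lambda>t. indicator {0..} t * (exp (x * t) * Phi t)) (\<integral>l. excess_lap x l \<partial>\<mu>)"
    using ae by (intro has_bochner_integral_nn_integral)
      (auto simp: eq nn_Phi[OF assms] Phi_nonneg intro!: nn_integral_eq_integral integrable_excess_lap integral_nonneg_AE assms)
  then show "integrable lborel (\<lambda>t. indicator {0..} t * (exp (x * t) * Phi t))"
    and "(\<integral>t. indicator {0..} t * (exp (x * t) * Phi t) \<partial>lborel) = (\<integral>l. excess_lap x l \<partial>\<mu>)"
    by (auto simp: has_bochner_integral_iff)
qed

text \<open>The ratio of the residues of the transforms of forcing and kernel at their common pole \<open>l = (2 * \<theta> * x - x\<^sup>2) / (4 * \<gamma>)\<close>, as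
functions of \<open>l\<close>.\<close>

definition kappa :: "real \<Rightarrow> real" where
  "kappa x = R * (2 * \<theta> - x) / (2 * \<gamma> * x) + 2 * R' / x\<^sup>2"

text \<open>As functions of \<open>l\<close>, the transforms of forcing and kernel have the same single pole. Therefore the former is a multiple of the
latter plus a polynomial of degree one, whose integral involves only the mass and the trace of \<open>\<mu>\<close>.\<close>

lemma excess_lap_partial_fractions:
  assumes "admissible x" "x > 0" "l = 0 \<or> lm \<le> l \<and> l \<le> lp"
  shows "excess_lap x l = kappa x * kern_lap x l - R' / (2 * x) * indicator {0<..} l
           - (\<gamma> * R' / ((\<theta> - x) * x\<^sup>2) + R / (2 * x)) * l"
proof (cases "l = 0")
  case False
  with assms lm have l: "lm \<le> l" "0 < l" by auto
  define D where "D = disc \<theta> (\<gamma> * l) x"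
  define p where "p = \<theta> - x"
  have D: "D > 0" "4 * \<gamma> * l = D + x * (x + 2 * p)"
    using admissible_disc[OF assms(1) l(1)] by (auto simp: D_def p_def disc_def algebra_simps power2_eq_square)
  have p: "p > 0" using assms by (simp add: admissible_def p_def)
  have th: "\<theta> = x + p" by (simp add: p_def)
  have Deq: "D = 4 * \<gamma> * l - x * (x + 2 * p)" using D by simp
  have "(R * l + R') / 2 * (2 / (p * D) * (\<gamma> * l + p * (x + 2 * p) / 2)) =
      (R * (x + 2 * p) / (2 * \<gamma> * x) + 2 * R' / x\<^sup>2) * (2 * \<gamma>\<^sup>2 * l\<^sup>2 / (p * D)) - R' / (2 * x)
      - (\<gamma> * R' / (p * x\<^sup>2) + R / (2 * x)) * l"
  proof -
    have "(R * l + R') * (\<gamma> * l + p * (x + 2 * p) / 2) * x\<^sup>2 =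
      R * (x + 2 * p) * \<gamma> * l\<^sup>2 * x + 4 * R' * \<gamma>\<^sup>2 * l\<^sup>2 - R' / 2 * x * p * D
      - \<gamma> * R' * l * D - R / 2 * x * l * p * D"
      unfolding Deq by (simp add: field_simps power2_eq_square)
    moreover have "(R * l + R') / 2 * (2 / (p * D) * (\<gamma> * l + p * (x + 2 * p) / 2)) * (p * D * x\<^sup>2)
        = (R * l + R') * (\<gamma> * l + p * (x + 2 * p) / 2) * x\<^sup>2"
      using D(1) p by simp
    moreover have "R * (x + 2 * p) / (2 * \<gamma> * x) * (2 * \<gamma>\<^sup>2 * l\<^sup>2 / (p * D)) * (p * D * x\<^sup>2) = R * (x + 2 * p) * \<gamma> * l\<^sup>2 * x"
      "2 * R' / x\<^sup>2 * (2 * \<gamma>\<^sup>2 * l\<^sup>2 / (p * D)) * (p * D * x\<^sup>2) = 4 * R' * \<gamma>\<^sup>2 * l\<^sup>2"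
      "R' / (2 * x) * (p * D * x\<^sup>2) = R' / 2 * x * p * D"
      "\<gamma> * R' / (p * x\<^sup>2) * l * (p * D * x\<^sup>2) = \<gamma> * R' * l * D"
      "R / (2 * x) * l * (p * D * x\<^sup>2) = R / 2 * x * l * p * D"
      using D(1) p assms(2) gamma by (simp_all add: power2_eq_square)
    ultimately have "(R * l + R') / 2 * (2 / (p * D) * (\<gamma> * l + p * (x + 2 * p) / 2)) * (p * D * x\<^sup>2) =
      ((R * (x + 2 * p) / (2 * \<gamma> * x) + 2 * R' / x\<^sup>2) * (2 * \<gamma>\<^sup>2 * l\<^sup>2 / (p * D)) - R' / (2 * x)
      - (\<gamma> * R' / (p * x\<^sup>2) + R / (2 * x)) * l) * (p * D * x\<^sup>2)"
      by (simp only: distrib_right left_diff_distrib)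
    then show ?thesis using D(1) p assms(2) by simp
  qed
  then show ?thesis using l
    by (simp add: excess_lap_def osc_form_def kern_lap_def kappa_def D_def p_def algebra_simps)
qed (simp add: excess_lap_def kern_lap_def)

lemma integral_excess_lap:
  assumes "admissible x" "x > 0"
  shows "(\<integral>l. excess_lap x l \<partial>\<mu>) = Finf / x + kappa x * M x - R' / (2 * x)
           - (\<gamma> * R' / ((\<theta> - x) * x\<^sup>2) + R / (2 * x)) * tr \<mu>"
proof -
  have ind: "(\<integral>l. indicator {0<..} l \<partial>\<mu>) = 1 - measure \<mu> {0}"
  proof -
    have "(\<integral>l. indicator {0<..} l \<partial>\<mu>) = (\<integral>l. (1 :: real) - indicator {0} l \<partial>\<mu>)"
      by (rule integral_cong_AE) (use AE_support lm in \<open>auto elim!: eventually_mono\<close>)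
    also have "\<dots> = (\<integral>l. 1 \<partial>\<mu>) - (\<integral>l. indicator {0} l \<partial>\<mu>)"
      by (rule Bochner_Integration.integral_diff)
        (auto simp: emeasure_eq_measure)
    finally show ?thesis using prob_space by simp
  qed
  have "(\<integral>l. excess_lap x l \<partial>\<mu>) = (\<integral>l. kappa x * kern_lap x l - R' / (2 * x) * indicator {0<..} l
           - (\<gamma> * R' / ((\<theta> - x) * x\<^sup>2) + R / (2 * x)) * l \<partial>\<mu>)"
    by (rule integral_cong_AE) 
      (use AE_support excess_lap_partial_fractions[OF assms] in \<open>auto elim!: eventually_mono\<close>)
  also have "\<dots> = kappa x * M x - R' / (2 * x) * (1 - measure \<mu> {0})
           - (\<gamma> * R' / ((\<theta> - x) * x\<^sup>2) + R / (2 * x)) * tr \<mu>"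
    unfolding M_def tr_eq ind[symmetric]
    by (subst Bochner_Integration.integral_diff;
        (intro Bochner_Integration.integrable_diff integrable_mult_right integrable_kern_lap integrable_id assms)?)
      (auto simp: emeasure_eq_measure integrable_kern_lap assms)
  finally have "(\<integral>l. excess_lap x l \<partial>\<mu>) = kappa x * M x - R' / (2 * x) * (1 - measure \<mu> {0})
           - (\<gamma> * R' / ((\<theta> - x) * x\<^sup>2) + R / (2 * x)) * tr \<mu>" .
  moreover have "Finf / x - R' / (2 * x) = - (R' / (2 * x) * (1 - measure \<mu> {0}))"
    using assms by (simp add: Finf_def field_simps)
  ultimately show ?thesis by linarith
qed

end

section \<open>Laplace transforms\<close>

lemma integral_convolution:
  fixes a b :: "real \<Rightarrow> real"
  assumes a: "integrable lborel a" and b: "integrable lborel b"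
  shows "(\<integral>t. (\<integral>s. a s * b (t - s) \<partial>lborel) \<partial>lborel) = (\<integral>s. a s \<partial>lborel) * (\<integral>t. b t \<partial>lborel)"
proof -
  have [measurable]: "a \<in> borel_measurable borel" "b \<in> borel_measurable borel"
    using a b by (auto dest: borel_measurable_integrable)
  have shift: "integrable lborel (\<lambda>t. b (t - s))" "(\<integral>t. f (b (t - s)) \<partial>lborel) = (\<integral>t. f (b t) \<partial>lborel)" for s and f :: "real \<Rightarrow> real"
    using lborel_integrable_real_affine[OF b, of 1 "- s"] lborel_integral_real_affine[of 1 "\<lambda>t. f (b t)" "- s"]
    by simp_all
  have int: "integrable (lborel \<Otimes>\<^sub>M lborel) (\<lambda>(s, t). a s * b (t - s))"
  proof (rule lborel_pair.Fubini_integrable)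
    show "integrable lborel (\<lambda>s. \<integral>t. norm (case (s, t) of (s, t) \<Rightarrow> a s * b (t - s)) \<partial>lborel)"
      using a by (auto simp: abs_mult shift(2)[of abs])
    show "AE s in lborel. integrable lborel (\<lambda>t. case (s, t) of (s, t) \<Rightarrow> a s * b (t - s))"
      by (simp add: shift)
  qed measurable
  show "(\<integral>t. (\<integral>s. a s * b (t - s) \<partial>lborel) \<partial>lborel) = (\<integral>s. a s \<partial>lborel) * (\<integral>t. b t \<partial>lborel)"
    unfolding lborel_pair.Fubini_integral[OF int] by (simp add: shift(2)[of "\<lambda>x. x"])
qed

definition laplace :: "(real \<Rightarrow> real) \<Rightarrow> complex \<Rightarrow> complex" where
  "laplace f z = (\<integral>t. complex_of_real (f t) * exp (- z * complex_of_real t) \<partial>lborel)"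

lemma laplace_real:
  "laplace f (- complex_of_real x) = complex_of_real (\<integral>t. f t * exp (x * t) \<partial>lborel)"
proof -
  have "complex_of_real (f t) * exp (- (- complex_of_real x) * complex_of_real t) = complex_of_real (f t * exp (x * t))" for t
    by (simp add: exp_of_real flip: of_real_mult)
  then show ?thesis unfolding laplace_def by (simp only: integral_complex_of_real)
qed

lemma sum_exp_terms_le:
  fixes x :: real
  assumes "0 \<le> x" "finite N"
  shows "(\<Sum>n\<in>N. x ^ n / fact n) \<le> exp x"
proof -
  have "(\<lambda>n. x ^ n / fact n) sums exp x"
    using exp_converges[of x] by (simp add: field_simps)
  then show ?thesis
    using assms sum_le_suminf[of "\<lambda>n. x ^ n / fact n" N] by (simp add: sums_iff)
qed

text \<open>The exponential series is integrated term by term. The series of absolute values is dominated by the weight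
\<open>exp (- (Re a - r) * t)\<close>.\<close>

lemma laplace_power_series:
  fixes f :: "real \<Rightarrow> real"
  assumes supp: "\<And>t. t < 0 \<Longrightarrow> f t = 0"
    and meas [measurable]: "f \<in> borel_measurable borel"
    and int: "integrable lborel (\<lambda>t. f t * exp (- (Re a - r) * t))"
    and z: "norm (z - a) \<le> r"
  shows "(\<lambda>n. (\<integral>t. complex_of_real (f t) * ((- complex_of_real t) ^ n / fact n) * exp (- a * complex_of_real t) \<partial>lborel) * (z - a) ^ n)
           sums laplace f z"
proof -
  define g where "g n t = complex_of_real (f t) * ((- complex_of_real t) ^ n / fact n) * exp (- a * complex_of_real t)" for n t
  define w where "w t = norm (f t * exp (- (Re a - r) * t))" for t
  have w: "integrable lborel w" unfolding w_def using int by (rule integrable_norm)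
  have [measurable]: "g n \<in> borel_measurable borel" for n unfolding g_def by measurable
  have rpos: "r \<ge> 0" using z norm_ge_zero order_trans by blast
  have term_bound: "norm (g n t * (z - a) ^ n) = \<bar>f t\<bar> * exp (- Re a * t) * ((norm (z - a) * t) ^ n / fact n)" for n t
  proof (cases "t \<ge> 0")
    case True
    then show ?thesis by (simp add: g_def norm_mult norm_divide norm_power power_mult_distrib)
  qed (use supp in \<open>simp add: g_def\<close>)
  have partial: "(\<Sum>n<N. \<bar>f t\<bar> * exp (- Re a * t) * ((norm (z - a) * t) ^ n / fact n)) \<le> w t" for N t
  proof (cases "t \<ge> 0")
    case True
    have "(\<Sum>n<N. (norm (z - a) * t) ^ n / fact n) \<le> exp (norm (z - a) * t)"
      using True by (intro sum_exp_terms_le) auto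
    also have "\<dots> \<le> exp (r * t)" using z True by (simp add: mult_right_mono)
    finally have "\<bar>f t\<bar> * exp (- Re a * t) * (\<Sum>n<N. (norm (z - a) * t) ^ n / fact n)
        \<le> \<bar>f t\<bar> * exp (- Re a * t) * exp (r * t)" by (intro mult_left_mono) auto
    also have "\<dots> = w t" by (simp add: w_def abs_mult algebra_simps flip: exp_add)
    finally show ?thesis by (simp add: sum_distrib_left)
  qed (use supp in \<open>simp add: w_def\<close>)
  have g_int: "integrable lborel (\<lambda>t. g n t * (z - a) ^ n)" for n
  proof (rule Bochner_Integration.integrable_bound[OF w])
    have "norm (g n t * (z - a) ^ n) \<le> norm (w t)" for t
    proof (cases "t \<ge> 0")
      case True
      have "\<bar>f t\<bar> * exp (- Re a * t) * ((norm (z - a) * t) ^ n / fact n) \<le> w t"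
        by (rule order_trans[OF _ partial[of t "Suc n"]], rule member_le_sum[of n "{..<Suc n}"]) (use True in auto)
      then show ?thesis unfolding term_bound by simp
    qed (use supp in \<open>simp add: g_def w_def\<close>)
    then show "AE t in lborel. norm (g n t * (z - a) ^ n) \<le> norm (w t)" by simp
  qed measurable
  have "(\<lambda>N. \<integral>t. (\<Sum>n<N. g n t * (z - a) ^ n) \<partial>lborel) \<longlonglongrightarrow> laplace f z"
    unfolding laplace_def
  proof (rule integral_dominated_convergence[where w = w])
    show "AE t in lborel. (\<lambda>N. \<Sum>n<N. g n t * (z - a) ^ n) \<longlonglongrightarrow> complex_of_real (f t) * exp (- z * complex_of_real t)"
    proof (intro AE_I2)
      fix t
      have "(\<lambda>n. (- (z - a) * complex_of_real t) ^ n /\<^sub>R fact n) sums exp (- (z - a) * complex_of_real t)"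
        by (rule exp_converges)
      then have "(\<lambda>n. complex_of_real (f t) * exp (- a * complex_of_real t) * ((- (z - a) * complex_of_real t) ^ n /\<^sub>R fact n))
          sums (complex_of_real (f t) * exp (- a * complex_of_real t) * exp (- (z - a) * complex_of_real t))"
        by (rule sums_mult)
      moreover have "complex_of_real (f t) * exp (- a * complex_of_real t) * ((- (z - a) * complex_of_real t) ^ n /\<^sub>R fact n)
          = g n t * (z - a) ^ n" for n
      proof -
        have "(- (z - a) * complex_of_real t) ^ n = (- complex_of_real t) ^ n * (z - a) ^ n"
          unfolding power_mult_distrib[symmetric] by (rule arg_cong[where f = "\<lambda>u. u ^ n"]) (simp add: algebra_simps)
        then show ?thesis unfolding g_def by (simp add: scaleR_conv_of_real field_simps)
      qed
      moreover have "exp (- a * complex_of_real t) * exp (- (z - a) * complex_of_real t) = exp (- z * complex_of_real t)"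
        by (simp add: algebra_simps flip: exp_add)
      ultimately show "(\<lambda>N. \<Sum>n<N. g n t * (z - a) ^ n) \<longlonglongrightarrow> complex_of_real (f t) * exp (- z * complex_of_real t)"
        by (simp add: sums_def mult.assoc)
    qed
    show "AE t in lborel. norm (\<Sum>n<N. g n t * (z - a) ^ n) \<le> w t" for N
      by (intro AE_I2 order_trans[OF norm_sum]) (unfold term_bound, rule partial)
  qed (use w in measurable)
  also have "(\<lambda>N. \<integral>t. (\<Sum>n<N. g n t * (z - a) ^ n) \<partial>lborel) = (\<lambda>N. \<Sum>n<N. (\<integral>t. g n t \<partial>lborel) * (z - a) ^ n)"
    using g_int by (simp add: Bochner_Integration.integral_sum)
  finally show ?thesis unfolding sums_def g_def .
qed

lemma has_bochner_integral_exp_decay: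
  fixes c :: real
  assumes "c > 0"
  shows "has_bochner_integral lborel (\<lambda>t. exp (- c * t) * indicator {0..} t) (1 / c)"
proof -
  have "((\<lambda>t. - exp (- c * t) / c) \<longlongrightarrow> 0) at_top" using assms by real_asymp
  then have "(\<integral>\<^sup>+t. ennreal (exp (- c * t)) * indicator {0..} t \<partial>lborel) = ennreal (0 - (- exp (- c * 0) / c))"
    using assms by (intro nn_integral_FTC_atLeast) (auto intro!: derivative_eq_intros)
  moreover have "ennreal (exp (- c * t) * indicator {0..} t) = ennreal (exp (- c * t)) * indicator {0..} t" for t
    by (auto simp: indicator_def)
  ultimately show ?thesis
    using assms by (intro has_bochner_integral_nn_integral) auto
qed

lemma exp_decay_integrable:
  fixes f :: "real \<Rightarrow> real"
  assumes supp: "\<And>t. t < 0 \<Longrightarrow> f t = 0"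
    and meas [measurable]: "f \<in> borel_measurable borel"
    and bound: "\<And>t. 0 \<le> t \<Longrightarrow> \<bar>f t\<bar> \<le> C * exp (- c * t)" and x: "x < c"
  shows "integrable lborel (\<lambda>t. f t * exp (x * t))"
proof (rule Bochner_Integration.integrable_bound)
  have "has_bochner_integral lborel (\<lambda>t. exp (- (c - x) * t) * indicator {0..} t) (1 / (c - x))"
    using x by (intro has_bochner_integral_exp_decay) simp
  then show "integrable lborel (\<lambda>t. C * (exp (- (c - x) * t) * indicator {0..} t))"
    by (auto simp: has_bochner_integral_iff)
  show "AE t in lborel. norm (f t * exp (x * t)) \<le> norm (C * (exp (- (c - x) * t) * indicator {0..} t))"
  proof (intro AE_I2)
    fix t
    show "norm (f t * exp (x * t)) \<le> norm (C * (exp (- (c - x) * t) * indicator {0..} t))"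
    proof (cases "t \<ge> 0")
      case True
      have "\<bar>f t\<bar> * exp (x * t) \<le> C * exp (- c * t) * exp (x * t)"
        using bound[OF True] by (intro mult_right_mono) auto
      also have "\<dots> = C * exp (- (c - x) * t)" by (simp add: algebra_simps flip: exp_add)
      also have "\<dots> \<le> \<bar>C\<bar> * exp (- (c - x) * t)" by (intro mult_right_mono) auto
      finally show ?thesis using True by (simp add: abs_mult)
    qed (use supp in simp)
  qed
qed measurable

lemma laplace_holomorphic:
  fixes f :: "real \<Rightarrow> real"
  assumes supp: "\<And>t. t < 0 \<Longrightarrow> f t = 0"
    and meas [measurable]: "f \<in> borel_measurable borel"
    and bound: "\<And>t. 0 \<le> t \<Longrightarrow> \<bar>f t\<bar> \<le> C * exp (- c * t)"
  shows "laplace f holomorphic_on {z. Re z > - c}"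
proof (rule holomorphic_onI)
  fix z0 assume "z0 \<in> {z. Re z > - c}"
  then have z0: "Re z0 > - c" by simp
  define r where "r = (Re z0 + c) / 2"
  have r: "r > 0" using z0 by (simp add: r_def)
  have "integrable lborel (\<lambda>t. f t * exp (- (Re z0 - r) * t))"
    by (rule exp_decay_integrable[OF supp meas bound]) (use z0 in \<open>auto simp: r_def field_simps\<close>)
  note series = laplace_power_series[OF supp meas this]
  have "laplace f holomorphic_on ball z0 r"
    by (rule power_series_holomorphic, rule series) (auto simp: dist_norm norm_minus_commute)
  then have "laplace f field_differentiable at z0"
    using r by (simp add: holomorphic_on_imp_differentiable_at)
  then show "laplace f field_differentiable at z0 within {z. Re z > - c}"
    by (rule field_differentiable_at_within)
qed

lemma laplace_bound:
  fixes f :: "real \<Rightarrow> real"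
  assumes supp: "\<And>t. t < 0 \<Longrightarrow> f t = 0"
    and meas [measurable]: "f \<in> borel_measurable borel"
    and bound: "\<And>t. 0 \<le> t \<Longrightarrow> \<bar>f t\<bar> \<le> C" and x: "x > 0"
  shows "norm (laplace f (complex_of_real x)) \<le> C / x"
proof -
  have "has_bochner_integral lborel (\<lambda>t. C * (exp (- x * t) * indicator {0..} t)) (C * (1 / x))"
    by (intro has_bochner_integral_mult_right has_bochner_integral_exp_decay x)
  then have B: "integrable lborel (\<lambda>t. C * (exp (- x * t) * indicator {0..} t))" "(\<integral>t. C * (exp (- x * t) * indicator {0..} t) \<partial>lborel) = C / x"
    by (auto simp: has_bochner_integral_iff)
  have "integrable lborel (\<lambda>t. f t * exp (- x * t))"
    by (rule exp_decay_integrable[OF supp meas, of C 0]) (use bound x in auto)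
  then have "integrable lborel (\<lambda>t. complex_of_real (f t * exp (- x * t)))" by (rule integrable_of_real)
  moreover have "complex_of_real (f t * exp (- x * t)) = complex_of_real (f t) * exp (- complex_of_real x * complex_of_real t)" for t
    by (simp only: of_real_mult exp_of_real[symmetric] of_real_minus)
  ultimately have I: "integrable lborel (\<lambda>t. complex_of_real (f t) * exp (- complex_of_real x * complex_of_real t))"
    by (simp only:)
  have "norm (laplace f (complex_of_real x)) \<le> (\<integral>t. C * (exp (- x * t) * indicator {0..} t) \<partial>lborel)"
    unfolding laplace_def
    by (rule order_trans[OF integral_norm_bound integral_mono[OF integrable_norm[OF I] B(1)]])
      (use bound supp in \<open>auto simp: norm_mult indicator_def\<close>)
  then show ?thesis using B by simp
qed


text \<open>Landau's theorem: the abscissa of convergence of the transform of a nonnegative function is a singularity. Expand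
around the point \<open>a = - (X - r / 4)\<close>. The continuation \<open>E\<close> has a power series with radius at least \<open>3 * r / 4\<close> there,
and its coefficients are the moments of \<open>g\<close> up to alternating signs. Evaluated to the left of \<open>- X\<close>, all its terms are nonnegative, so sum and integral
can be interchanged back to give convergence beyond \<open>X\<close>.\<close>

lemma landau_laplace:
  fixes g :: "real \<Rightarrow> real"
  assumes supp: "\<And>t. t < 0 \<Longrightarrow> g t = 0"
    and nonneg: "\<And>t. 0 \<le> g t"
    and meas [measurable]: "g \<in> borel_measurable borel"
    and int: "\<And>x. x < X \<Longrightarrow> integrable lborel (\<lambda>t. g t * exp (x * t))"
    and r: "r > 0"
    and hol: "E holomorphic_on ball (- complex_of_real X) r"
    and eq: "\<And>x. X - r < x \<Longrightarrow> x < X \<Longrightarrow> E (- complex_of_real x) = complex_of_real (\<integral>t. g t * exp (x * t) \<partial>lborel)"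
  shows "\<exists>x>X. integrable lborel (\<lambda>t. g t * exp (x * t))"
proof -
  define b where "b = X - r / 4"
  define a where "a = - complex_of_real b"
  define c where "c n = (\<integral>t. complex_of_real (g t) * ((- complex_of_real t) ^ n / fact n) * exp (- a * complex_of_real t) \<partial>lborel)" for n
  have Re_a: "Re a = - b" by (simp add: a_def)
  have sub: "ball a (3 * r / 4) \<subseteq> ball (- complex_of_real X) r"
  proof
    fix z assume "z \<in> ball a (3 * r / 4)"
    moreover have "dist (- complex_of_real X) a = r / 4"
      unfolding a_def b_def dist_norm using r by (simp flip: of_real_minus of_real_diff)
    ultimately show "z \<in> ball (- complex_of_real X) r"
      using dist_triangle[of "- complex_of_real X" z a] by simp
  qed
  have series: "(\<lambda>n. c n * (z - a) ^ n) sums laplace g z" if "norm (z - a) \<le> r / 8" for z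
    unfolding c_def
    by (rule laplace_power_series[OF supp meas _ that]) (use int[of "b + r / 8"] r in \<open>simp_all add: Re_a b_def\<close>)
  have lap_hol: "laplace g holomorphic_on ball a (r / 8)"
    by (rule power_series_holomorphic, rule series) (simp add: dist_norm norm_minus_commute)
  have E_hol: "E holomorphic_on ball a (3 * r / 4)"
    using hol sub by (rule holomorphic_on_subset)
  have E_eq: "E z = laplace g z" if z: "z \<in> ball a (r / 8)" for z
  proof -
    define U where "U = (\<lambda>x. - complex_of_real x) ` {b<..<b + r / 8}"
    have "E z - laplace g z = 0"
    proof (rule analytic_continuation[of "\<lambda>z. E z - laplace g z" "ball a (r / 8)" U a])
      show "(\<lambda>z. E z - laplace g z) holomorphic_on ball a (r / 8)"
        using r by (intro holomorphic_intros lap_hol holomorphic_on_subset[OF E_hol]) auto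
      show "U \<subseteq> ball a (r / 8)"
        unfolding U_def a_def by (auto simp: dist_norm simp flip: of_real_diff of_real_minus)
      show "a islimpt U"
        unfolding islimpt_approachable
      proof (intro allI impI)
        fix e :: real assume e: "e > 0"
        define d where "d = min (e / 2) (r / 16)"
        have d: "0 < d" "d < e" "d < r / 8" using e r by (auto simp: d_def)
        have "- complex_of_real (b + d) \<in> U" using d by (auto simp: U_def simp del: of_real_add)
        moreover have "- complex_of_real (b + d) \<noteq> a" "dist (- complex_of_real (b + d)) a < e"
          using d by (simp_all add: a_def dist_norm)
        ultimately show "\<exists>x'\<in>U. x' \<noteq> a \<and> dist x' a < e" by blast
      qed
      show "E z - laplace g z = 0" if "z \<in> U" for z
        using that r by (auto simp: U_def laplace_real b_def intro!: eq)
    qed (use r z in auto)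
    then show ?thesis by simp
  qed
  have coeff: "(deriv ^^ n) E a / fact n = c n" for n
  proof -
    have e: "eventually (\<lambda>u. u \<in> ball 0 (r / 8)) (nhds (0 :: complex))"
      using r by (intro eventually_nhds_in_open) auto
    have "(\<lambda>u. E (a + u)) has_fps_expansion Abs_fps c"
    proof (rule has_fps_expansionI, rule eventually_mono[OF e])
      fix u :: complex assume "u \<in> ball 0 (r / 8)"
      then show "(\<lambda>n. fps_nth (Abs_fps c) n * u ^ n) sums E (a + u)"
        using series[of "a + u"] E_eq[of "a + u"] by (simp add: dist_norm)
    qed
    moreover have "(\<lambda>u. E (a + u)) has_fps_expansion Abs_fps (\<lambda>n. (deriv ^^ n) E a / fact n)"
    proof (rule has_fps_expansionI, rule eventually_mono[OF e])
      fix u :: complex assume "u \<in> ball 0 (r / 8)"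
      then show "(\<lambda>n. fps_nth (Abs_fps (\<lambda>n. (deriv ^^ n) E a / fact n)) n * u ^ n) sums E (a + u)"
        using holomorphic_power_series[OF E_hol, of "a + u"] r by (simp add: dist_norm)
    qed
    ultimately have "Abs_fps c = Abs_fps (\<lambda>n. (deriv ^^ n) E a / fact n)"
      by (rule fps_expansion_unique_complex)
    then show ?thesis by (metis fps_nth_Abs_fps)
  qed
  define h where "h n t = g t * ((r / 2 * t) ^ n / fact n) * exp (b * t)" for n t
  have h_nonneg: "0 \<le> h n t" for n t
    using supp[of t] nonneg[of t] r by (cases "t \<ge> 0") (auto simp: h_def)
  have [measurable]: "h n \<in> borel_measurable borel" for n unfolding h_def by measurable
  have c_h: "c n * (- complex_of_real (r / 2)) ^ n = complex_of_real (\<integral>t. h n t \<partial>lborel)" for n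
  proof -
    have "complex_of_real (g t) * ((- complex_of_real t) ^ n / fact n) * exp (- a * complex_of_real t) * (- complex_of_real (r / 2)) ^ n
        = complex_of_real (h n t)" for t
    proof -
      have "(- complex_of_real t) ^ n * (- complex_of_real (r / 2)) ^ n = complex_of_real ((r / 2 * t) ^ n)"
        unfolding power_mult_distrib[symmetric] of_real_power
        by (rule arg_cong[where f = "\<lambda>u. u ^ n"]) (simp add: mult.commute)
      moreover have "exp (- a * complex_of_real t) = complex_of_real (exp (b * t))"
        by (simp add: a_def exp_of_real[symmetric])
      ultimately show ?thesis unfolding h_def
        by (simp add: mult_ac)
    qed
    then show ?thesis unfolding c_def
      by (simp only: integral_mult_left_zero[symmetric] integral_complex_of_real)
  qed
  have h_int: "integrable lborel (h n)" for n
  proof (rule Bochner_Integration.integrable_bound)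
    show "integrable lborel (\<lambda>t. (4 ^ n) * (g t * exp ((b + r / 8) * t)))"
      using int[of "b + r / 8"] r by (intro integrable_mult_right) (simp add: b_def)
    show "AE t in lborel. norm (h n t) \<le> norm (4 ^ n * (g t * exp ((b + r / 8) * t)))"
    proof (intro AE_I2)
      fix t
      show "norm (h n t) \<le> norm (4 ^ n * (g t * exp ((b + r / 8) * t)))"
      proof (cases "t \<ge> 0")
        case True
        have "(r / 8 * t) ^ n / fact n \<le> exp (r / 8 * t)"
          using sum_exp_terms_le[of "r / 8 * t" "{n}"] True r by simp
        then have "4 ^ n * ((r / 8 * t) ^ n / fact n) \<le> 4 ^ n * exp (r / 8 * t)"
          by (intro mult_left_mono) auto
        moreover have "4 ^ n * (r / 8 * t) ^ n = (r / 2 * t) ^ n"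
          unfolding power_mult_distrib[symmetric] by (rule arg_cong[where f = "\<lambda>u. u ^ n"]) simp
        ultimately have "(r / 2 * t) ^ n / fact n \<le> 4 ^ n * exp (r / 8 * t)"
          by (simp only: times_divide_eq_right)
        then have "g t * ((r / 2 * t) ^ n / fact n) * exp (b * t) \<le> g t * (4 ^ n * exp (r / 8 * t)) * exp (b * t)"
          using nonneg by (intro mult_right_mono mult_left_mono) auto
        then have "h n t \<le> 4 ^ n * (g t * exp ((b + r / 8) * t))"
          by (simp only: h_def distrib_right exp_add) (simp add: mult_ac)
        then show ?thesis using h_nonneg nonneg by simp
      qed (simp add: supp h_def)
    qed
  qed measurable
  have "(\<lambda>n. c n * (- complex_of_real (r / 2)) ^ n) sums E (a - complex_of_real (r / 2))"
    using holomorphic_power_series[OF E_hol, of "a - complex_of_real (r / 2)"] r coeff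
    by (simp add: dist_norm)
  then have "summable (\<lambda>n. complex_of_real (\<integral>t. h n t \<partial>lborel))"
    unfolding c_h by (rule sums_summable)
  then have summ: "summable (\<lambda>n. \<integral>t. h n t \<partial>lborel)" by (simp add: summable_of_real_iff)
  have h_sum: "(\<Sum>n. ennreal (h n t)) = ennreal (g t * exp ((X + r / 4) * t))" for t
  proof -
    have "(\<lambda>n. g t * exp (b * t) * ((r / 2 * t) ^ n /\<^sub>R fact n)) sums (g t * exp (b * t) * exp (r / 2 * t))"
      by (intro sums_mult exp_converges)
    moreover have "g t * exp (b * t) * ((r / 2 * t) ^ n /\<^sub>R fact n) = h n t" for n
      by (simp add: h_def field_simps)
    moreover have "g t * exp (b * t) * exp (r / 2 * t) = g t * exp ((X + r / 4) * t)"
      by (simp add: b_def algebra_simps flip: exp_add)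
    ultimately have "(\<lambda>n. h n t) sums (g t * exp ((X + r / 4) * t))" by (simp only:)
    then show ?thesis using h_nonneg by (intro suminf_ennreal_eq)
  qed
  have "(\<integral>\<^sup>+t. ennreal (g t * exp ((X + r / 4) * t)) \<partial>lborel) = (\<Sum>n. \<integral>\<^sup>+t. ennreal (h n t) \<partial>lborel)"
    unfolding h_sum[symmetric] by (rule nn_integral_suminf) measurable
  also have "\<dots> = (\<Sum>n. ennreal (\<integral>t. h n t \<partial>lborel))"
    using h_int h_nonneg by (simp add: nn_integral_eq_integral)
  also have "\<dots> = ennreal (\<Sum>n. \<integral>t. h n t \<partial>lborel)"
    using summ h_nonneg by (intro suminf_ennreal2) auto
  finally have "integrable lborel (\<lambda>t. g t * exp ((X + r / 4) * t))"
    using nonneg by (intro integrableI_nonneg) auto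
  then show ?thesis using r by (intro exI[of _ "X + r / 4"]) simp
qed

section \<open>Bounds for the transform of the kernel\<close>

context sdahb
begin

lemma admissible_mono:
  assumes "admissible y" "x \<le> y"
  shows "admissible x" "disc \<theta> k y \<le> disc \<theta> k x"
proof -
  have y: "y < \<theta>" using assms by (simp add: admissible_def)
  have *: "disc \<theta> k y \<le> disc \<theta> k x" for k
  proof -
    have "disc \<theta> k x - disc \<theta> k y = (y - x) * (2 * \<theta> - x - y)"
      by (simp add: disc_def algebra_simps power2_eq_square)
    also have "\<dots> \<ge> 0" using assms y by (intro mult_nonneg_nonneg) auto
    finally show ?thesis by simp
  qed
  show "disc \<theta> k y \<le> disc \<theta> k x" by (rule *)
  show "admissible x" using assms y *[of "\<gamma> * lm"] by (auto simp: admissible_def)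
qed

lemma kern_lap_mono:
  assumes "admissible y" "x \<le> y" "l = 0 \<or> lm \<le> l \<and> l \<le> lp"
  shows "kern_lap x l \<le> kern_lap y l"
proof (cases "l = 0")
  case False
  with assms(3) have l: "lm \<le> l" by auto
  have d: "0 < disc \<theta> (\<gamma> * l) y" "y < \<theta>" using admissible_disc(2)[OF assms(1) l] assms by (auto simp: admissible_def)
  then show ?thesis unfolding kern_lap_def using admissible_mono(2)[OF assms(1,2), of "\<gamma> * l"] assms(2)
    by (intro divide_left_mono mult_mono mult_pos_pos) auto
qed (simp add: kern_lap_def)

lemma M_continuous_on:
  assumes "admissible y"
  shows "continuous_on {0..y} M"
  unfolding continuous_on_sequentially
proof (intro allI ballI impI)
  fix X x assume x: "x \<in> {0..y}" and X: "(\<forall>n. X n \<in> {0..y}) \<and> X \<longlonglongrightarrow> x"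
  have gx: "admissible x" using admissible_mono[OF assms] x by auto
  have gX: "admissible (X n)" "X n \<le> y" for n using admissible_mono[OF assms] X by auto
  have "(\<lambda>n. \<integral>l. kern_lap (X n) l \<partial>\<mu>) \<longlonglongrightarrow> (\<integral>l. kern_lap x l \<partial>\<mu>)"
  proof (rule integral_dominated_convergence[where w = "kern_lap y"])
    show "AE l in \<mu>. (\<lambda>n. kern_lap (X n) l) \<longlonglongrightarrow> kern_lap x l"
      using AE_support
    proof eventually_elim
      case (elim l)
      show ?case
      proof (cases "l = 0")
        case False
        with elim have l: "lm \<le> l" by auto
        show ?thesis unfolding kern_lap_def disc_def
          using admissible_disc(2)[OF gx l] gx X unfolding disc_def admissible_def
          by (intro tendsto_intros) auto
      qed (simp add: kern_lap_def)
    qed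
    show "AE l in \<mu>. norm (kern_lap (X n) l) \<le> kern_lap y l" for n
      using AE_support
      by eventually_elim (use kern_lap_mono[OF assms gX(2)[of n]] kern_lap_bounds(1)[OF gX(1)[of n]] in auto)
  qed (use integrable_kern_lap[OF assms] in auto)
  then show "(M \<circ> X) \<longlonglongrightarrow> M x" by (simp add: M_def o_def)
qed

text \<open>The ratio of the integrands at \<open>x\<close> and at \<open>0\<close> decreases in \<open>l\<close>, so that it is largest at \<open>lm\<close>.\<close>

lemma M_upper:
  assumes "admissible x" "0 \<le> x"
  shows "M x \<le> M 0 * (\<theta> * (4 * \<gamma> * lm) / ((\<theta> - x) * disc \<theta> (\<gamma> * lm) x))"
proof -
  define q where "q = 2 * \<theta> * x - x\<^sup>2"
  have x: "x < \<theta>" using assms by (simp add: admissible_def)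
  have "q = x * (2 * \<theta> - x)" by (simp add: q_def power2_eq_square algebra_simps)
  then have q: "q \<ge> 0" using assms x by simp
  have dq: "disc \<theta> (\<gamma> * l) x = 4 * \<gamma> * l - q" for l by (simp add: disc_def q_def)
  have dlm: "4 * \<gamma> * lm - q > 0" using assms dq by (simp add: admissible_def)
  have "M x \<le> (\<integral>l. \<gamma> / (2 * \<theta>) * (\<theta> * (4 * \<gamma> * lm) / ((\<theta> - x) * disc \<theta> (\<gamma> * lm) x)) * l \<partial>\<mu>)"
    unfolding M_def
  proof (intro integral_mono_AE integrable_kern_lap assms integrable_mult_right integrable_id)
    show "AE l in \<mu>. kern_lap x l \<le> \<gamma> / (2 * \<theta>) * (\<theta> * (4 * \<gamma> * lm) / ((\<theta> - x) * disc \<theta> (\<gamma> * lm) x)) * l"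
      using AE_support
    proof eventually_elim
      case (elim l)
      show ?case
      proof (cases "l = 0")
        case False
        with elim have l: "lm \<le> l" by auto
        have l0: "l > 0" using l lm by simp
        have gl: "4 * \<gamma> * lm \<le> 4 * \<gamma> * l" using l gamma by simp
        have dl: "4 * \<gamma> * l - q > 0" using gl dlm by linarith
        have "q * (4 * \<gamma> * lm) \<le> q * (4 * \<gamma> * l)" using q gl by (rule mult_left_mono[rotated])
        then have "4 * \<gamma> * l * (4 * \<gamma> * lm - q) \<le> 4 * \<gamma> * lm * (4 * \<gamma> * l - q)"
          by (simp add: algebra_simps)
        then have "4 * \<gamma> * l / (4 * \<gamma> * l - q) \<le> 4 * \<gamma> * lm / (4 * \<gamma> * lm - q)"
          using dl dlm by (simp add: divide_le_eq pos_le_divide_eq)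
        then have "\<gamma> * l / (2 * (\<theta> - x)) * (4 * \<gamma> * l / (4 * \<gamma> * l - q)) \<le> \<gamma> * l / (2 * (\<theta> - x)) * (4 * \<gamma> * lm / (4 * \<gamma> * lm - q))"
          using gamma l0 x by (intro mult_left_mono) auto
        moreover have "kern_lap x l = \<gamma> * l / (2 * (\<theta> - x)) * (4 * \<gamma> * l / (4 * \<gamma> * l - q))"
        proof -
          have "2 * g\<^sup>2 * l\<^sup>2 / (p * D) = g * l / (2 * p) * (4 * g * l / D)" for g p D :: real
            by (simp add: power2_eq_square)
          then show ?thesis unfolding kern_lap_def dq .
        qed
        moreover have "\<gamma> / (2 * \<theta>) * (\<theta> * (4 * \<gamma> * lm) / ((\<theta> - x) * disc \<theta> (\<gamma> * lm) x)) * l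
            = \<gamma> * l / (2 * (\<theta> - x)) * (4 * \<gamma> * lm / (4 * \<gamma> * lm - q))"
        proof -
          have "g / (2 * h) * (h * (4 * g * m) / (p * E)) * l = g * l / (2 * p) * (4 * g * m / E)"
            if "h \<noteq> 0" for g h m p E :: real
            using that by simp
          from this[OF theta[THEN less_imp_neq, symmetric]] show ?thesis unfolding dq .
        qed
        ultimately show ?thesis by linarith
      qed (simp add: kern_lap_def)
    qed
  qed
  also have "\<dots> = M 0 * (\<theta> * (4 * \<gamma> * lm) / ((\<theta> - x) * disc \<theta> (\<gamma> * lm) x))"
    by (simp add: M_0 tr_eq)
  finally show ?thesis .
qed

lemma M_lower:
  assumes "admissible x" "0 \<le> x"
  shows "\<gamma> * tr \<mu> / (2 * (\<theta> - x)) \<le> M x"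
proof -
  have x: "x < \<theta>" using assms by (simp add: admissible_def)
  have "0 \<le> x * (2 * \<theta> - x)" using assms x by simp
  then have q: "2 * \<theta> * x - x\<^sup>2 \<ge> 0" by (simp add: power2_eq_square algebra_simps)
  have "(\<integral>l. \<gamma> / (2 * (\<theta> - x)) * l \<partial>\<mu>) \<le> M x"
    unfolding M_def
  proof (intro integral_mono_AE integrable_kern_lap assms integrable_mult_right integrable_id)
    show "AE l in \<mu>. \<gamma> / (2 * (\<theta> - x)) * l \<le> kern_lap x l"
      using AE_support
    proof eventually_elim
      case (elim l)
      show ?case
      proof (cases "l = 0")
        case False
        with elim have l: "lm \<le> l" by auto
        have l0: "l > 0" using l lm by simp
        have d: "disc \<theta> (\<gamma> * l) x > 0" "disc \<theta> (\<gamma> * l) x \<le> 4 * \<gamma> * l" 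
          using admissible_disc(2)[OF assms(1) l] q by (auto simp: disc_def)
        have "g / (2 * p) * l = 2 * g\<^sup>2 * l\<^sup>2 / (p * (4 * g * l))" if "g > 0" "p > 0" for g p :: real
          using that l0 by (simp add: power2_eq_square)
        then have "\<gamma> / (2 * (\<theta> - x)) * l = 2 * \<gamma>\<^sup>2 * l\<^sup>2 / ((\<theta> - x) * (4 * \<gamma> * l))"
          using gamma x by (metis diff_gt_0_iff_gt)
        also have "\<dots> \<le> kern_lap x l" unfolding kern_lap_def
          using d x gamma l0 by (intro divide_left_mono mult_left_mono mult_pos_pos) auto
        finally show ?thesis .
      qed (simp add: kern_lap_def)
    qed
  qed
  then show ?thesis by (simp add: tr_eq)
qed

text \<open>Two constraints are combined: \<open>M_lower\<close> gives \<open>\<gamma> * tr \<mu> \<le> 2 * (\<theta> - x)\<close>, and convergence at \<open>lm\<close> gives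
\<open>x * (2 * \<theta> - x) < 4 * \<gamma> * lm\<close>. Eliminating \<open>\<gamma>\<close> leaves \<open>x \<le> (8 * lm / tr \<mu>) * (\<theta> - x) / (2 * \<theta> - x)\<close>, and the last quotient is at most \<open>1/2\<close>.\<close>

lemma rate_le_if_M_le_1:
  assumes "admissible x" "0 \<le> x" "M x \<le> 1"
  shows "x \<le> 4 * lm / tr \<mu>"
proof -
  have x: "x < \<theta>" using assms by (simp add: admissible_def)
  have "\<gamma> * tr \<mu> / (2 * (\<theta> - x)) \<le> 1" using M_lower[OF assms(1,2)] assms(3) by linarith
  then have g: "\<gamma> * tr \<mu> \<le> 2 * (\<theta> - x)" using x by (simp add: field_simps)
  have "x * (2 * \<theta> - x) < 4 * \<gamma> * lm" using assms(1) by (simp add: admissible_def disc_def power2_eq_square algebra_simps)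
  then have "tr \<mu> * (x * (2 * \<theta> - x)) \<le> tr \<mu> * (4 * \<gamma> * lm)" using tr_pos by simp
  also have "\<dots> = 4 * lm * (\<gamma> * tr \<mu>)" by simp
  also have "\<dots> \<le> 4 * lm * (2 * (\<theta> - x))" using g lm by (intro mult_left_mono) auto
  also have "\<dots> \<le> 4 * lm * (2 * \<theta> - x)" using assms lm by (intro mult_left_mono) auto
  finally have "(tr \<mu> * x) * (2 * \<theta> - x) \<le> (4 * lm) * (2 * \<theta> - x)" by (simp add: mult_ac)
  then have "tr \<mu> * x \<le> 4 * lm" using x theta by (simp add: mult_le_cancel_right)
  then show ?thesis using tr_pos by (simp add: field_simps)
qed

lemma exists_M_less_1:
  assumes "M 0 < 1"
  shows "\<exists>x>0. admissible x \<and> M x < 1"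
proof -
  have "((\<lambda>x. M 0 * (\<theta> * (4 * \<gamma> * lm) / ((\<theta> - x) * disc \<theta> (\<gamma> * lm) x))) \<longlongrightarrow>
      M 0 * (\<theta> * (4 * \<gamma> * lm) / ((\<theta> - 0) * disc \<theta> (\<gamma> * lm) 0))) (at_right 0)"
    using gamma theta lm unfolding disc_def by (intro tendsto_intros) auto
  also have "M 0 * (\<theta> * (4 * \<gamma> * lm) / ((\<theta> - 0) * disc \<theta> (\<gamma> * lm) 0)) = M 0"
    using gamma theta lm by (simp add: disc_def)
  finally have 1: "eventually (\<lambda>x. M 0 * (\<theta> * (4 * \<gamma> * lm) / ((\<theta> - x) * disc \<theta> (\<gamma> * lm) x)) < 1) (at_right 0)"
    using assms by (rule order_tendstoD(2))
  have "((\<lambda>x. disc \<theta> (\<gamma> * lm) x) \<longlongrightarrow> disc \<theta> (\<gamma> * lm) 0) (at_right 0)" unfolding disc_def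
    by (intro tendsto_intros)
  then have 2: "eventually (\<lambda>x. disc \<theta> (\<gamma> * lm) x > 0) (at_right 0)"
    using admissible_0 order_tendstoD(1) unfolding admissible_def by blast
  have 3: "eventually (\<lambda>x. x \<in> {0<..<\<theta>}) (at_right 0)" using theta eventually_at_right_real by blast
  have "eventually (\<lambda>x. x > 0 \<and> admissible x \<and> M x < 1) (at_right 0)"
    using 1 2 3 by eventually_elim (auto simp: admissible_def intro: le_less_trans[OF M_upper])
  then show ?thesis
    using eventually_happens'[OF trivial_limit_at_right_real] by blast
qed

text \<open>Eigenvalues slightly above \<open>lm\<close> carry positive mass, and at \<open>x\<close> they are beyond their own abscissa. For them the weighted integral
is infinite: it dominates the finite integrals at smaller \<open>x'\<close>, which explode as \<open>disc\<close> tends to \<open>0\<close>.\<close>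

lemma kernel_not_integrable:
  assumes x: "0 < x" "x < \<theta>" and neg: "disc \<theta> (\<gamma> * lm) x < 0"
  shows "\<not> integrable lborel (\<lambda>t. indicator {0..} t * (exp (x * t) * kernel \<mu> \<gamma> \<theta> t))"
proof
  let ?N = "\<lambda>x l. \<integral>\<^sup>+t. ennreal (exp (x * t) * (osc_y \<theta> (\<gamma> * l) t)\<^sup>2) * indicator {0..} t \<partial>lborel"
  assume "integrable lborel (\<lambda>t. indicator {0..} t * (exp (x * t) * kernel \<mu> \<gamma> \<theta> t))"
  then have "(\<integral>\<^sup>+t. ennreal (norm (indicator {0..} t * (exp (x * t) * kernel \<mu> \<gamma> \<theta> t))) \<partial>lborel) < \<infinity>"
    by (simp add: integrable_iff_bounded)
  also have "(\<integral>\<^sup>+t. ennreal (norm (indicator {0..} t * (exp (x * t) * kernel \<mu> \<gamma> \<theta> t))) \<partial>lborel)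
      = (\<integral>\<^sup>+t. ennreal (exp (x * t) * kernel \<mu> \<gamma> \<theta> t) * indicator {0..} t \<partial>lborel)"
    by (intro nn_integral_cong) (auto simp: indicator_def kernel_nonneg abs_mult)
  finally have "(\<integral>\<^sup>+l. ennreal (\<gamma>\<^sup>2 * l\<^sup>2) * ?N x l \<partial>\<mu>) \<noteq> \<infinity>" unfolding nn_kernel by simp
  then have ae: "AE l in \<mu>. ennreal (\<gamma>\<^sup>2 * l\<^sup>2) * ?N x l \<noteq> \<infinity>"
    by (intro nn_integral_noteq_infinite) auto
  define \<epsilon> where "\<epsilon> = - disc \<theta> (\<gamma> * lm) x / (4 * \<gamma>)"
  have eps: "\<epsilon> > 0" using neg gamma by (simp add: \<epsilon>_def divide_neg_pos)
  have "\<exists>l. l \<in> {lm..<lm + \<epsilon>} \<and> ennreal (\<gamma>\<^sup>2 * l\<^sup>2) * ?N x l \<noteq> \<infinity>"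
  proof (rule ccontr)
    assume "\<not> ?thesis"
    then have "AE l in \<mu>. l \<notin> {lm..<lm + \<epsilon>}" using ae by (auto elim!: eventually_mono)
    then have "measure \<mu> {lm..<lm + \<epsilon>} = measure \<mu> {}"
      by (intro measure_eq_AE) auto
    then show False using measure_near_lm[OF eps] by simp
  qed
  then obtain l where l: "lm \<le> l" "l < lm + \<epsilon>" and fin: "ennreal (\<gamma>\<^sup>2 * l\<^sup>2) * ?N x l \<noteq> \<infinity>" by auto
  define k where "k = \<gamma> * l"
  have k: "k > 0" using l lm gamma by (simp add: k_def)
  have "4 * \<gamma> * l < 4 * \<gamma> * (lm + \<epsilon>)" using l gamma by simp
  also have "\<dots> = 4 * \<gamma> * lm - disc \<theta> (\<gamma> * lm) x" using gamma by (simp add: \<epsilon>_def field_simps)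
  finally have neg_l: "disc \<theta> k x < 0" by (simp add: disc_def k_def)
  have "ennreal (\<gamma>\<^sup>2 * l\<^sup>2) > 0" using gamma l lm by simp
  with fin have "?N x l \<noteq> \<infinity>" by (auto simp: ennreal_mult_eq_top_iff)
  then obtain c where c: "?N x l = ennreal c" "c \<ge> 0" by (cases "?N x l") auto
  define \<delta> where "\<delta> = min (2 * k) (1 / (\<theta> * (c + 1)))"
  have delta: "0 < \<delta>" "\<delta> < 4 * k" "\<delta> \<le> 1 / (\<theta> * (c + 1))" using k theta c by (auto simp: \<delta>_def)
  have "\<exists>x'\<ge>0. x' \<le> x \<and> disc \<theta> k x' = \<delta>"
  proof (rule IVT2')
    show "disc \<theta> k x \<le> \<delta>" "\<delta> \<le> disc \<theta> k 0" using neg_l delta by (auto simp: disc_def)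
    show "continuous_on {0..x} (disc \<theta> k)" unfolding disc_def by (intro continuous_intros)
  qed (use x in auto)
  then obtain x' where x': "0 \<le> x'" "x' \<le> x" "disc \<theta> k x' = \<delta>" by blast
  have "ennreal (2 / ((\<theta> - x') * \<delta>)) = ?N x' l"
    using x' x delta unfolding k_def[symmetric]
    by (subst damped_oscillator.nn_integral_exp_sq[OF damped_oscillator_y]) (auto simp: osc_form_def)
  also have "\<dots> \<le> ?N x l"
    using x' by (intro nn_integral_mono) (auto simp: indicator_def intro!: ennreal_leI mult_right_mono)
  finally have "2 / ((\<theta> - x') * \<delta>) \<le> c" unfolding c(1) using c(2) by simp
  moreover have "c + 1 \<le> 1 / (\<theta> * \<delta>)"
  proof -
    have "\<theta> * (c + 1) * \<delta> \<le> \<theta> * (c + 1) * (1 / (\<theta> * (c + 1)))" using delta theta c by (intro mult_left_mono) auto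
    also have "\<dots> = 1" using theta c by simp
    finally show ?thesis using theta delta by (simp add: field_simps)
  qed
  moreover have "1 / (\<theta> * \<delta>) \<le> 2 / ((\<theta> - x') * \<delta>)"
    using x' x theta delta by (intro frac_le mult_right_mono mult_pos_pos) auto
  ultimately show False by linarith
qed


section \<open>The renewal equation\<close>

definition ker :: "real \<Rightarrow> real" where "ker t = indicator {0..} t * kernel \<mu> \<gamma> \<theta> t"

lemma measurable_ker [measurable]: "ker \<in> borel_measurable borel"
  unfolding ker_def by measurable

lemma ker_nonneg: "0 \<le> ker t"
  using kernel_nonneg by (simp add: ker_def)

lemma ker_le: "ker t \<le> \<gamma> * tr \<mu>"
  using kernel_le[of t] gamma tr_pos by (auto simp: ker_def indicator_def)

lemma
  assumes "admissible x"
  shows integrable_ker: "integrable lborel (\<lambda>t. ker t * exp (x * t))"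
    and integral_ker: "(\<integral>t. ker t * exp (x * t) \<partial>lborel) = M x"
  using integrable_kernel[OF assms] integral_kernel[OF assms] by (simp_all add: ker_def mult_ac)

lemma lborel_integral_reflect:
  fixes f :: "real \<Rightarrow> real"
  shows "(\<integral>s. f (t - s) \<partial>lborel) = (\<integral>s. f s \<partial>lborel)"
    and "integrable lborel f \<Longrightarrow> integrable lborel (\<lambda>s. f (t - s))"
  using lborel_integral_real_affine[of "-1" f t] lborel_integrable_real_affine[of f "-1" t] by simp_all

end

locale sdahb_solution = sdahb +
  fixes L :: "real \<Rightarrow> real"
  assumes loss: "sdahb_loss \<mu> R R' \<gamma> \<theta> L" and M0: "M 0 < 1"
begin

definition L0 :: "real \<Rightarrow> real" where "L0 t = indicator {0..} t * L t"

definition Linf :: real where "Linf = Finf / (1 - M 0)"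

definition D :: "real \<Rightarrow> real" where "D t = L0 t - Linf"

text \<open>On negative times \<open>D\<close> equals \<open>- Linf\<close>. The value \<open>- Finf\<close> for the inhomogeneity there is what makes the renewal equation hold on the
whole line; this replaces an explicit tail integral of the kernel.\<close>

definition P :: "real \<Rightarrow> real" where "P t = indicator {0..} t * Phi t - indicator {..<0} t * Finf"

lemma integrable_L_window: "integrable lborel (\<lambda>s. indicator {0..t} s * L s)"
proof (cases "t \<ge> 0")
  case True
  then show ?thesis using loss by (auto simp: sdahb_loss_def set_integrable_def)
qed simp

lemma measurable_L0 [measurable]: "L0 \<in> borel_measurable borel"
proof (rule borel_measurable_LIMSEQ_real)
  show "(\<lambda>s. indicator {0..real n} s * L s) \<in> borel_measurable borel" for n
    using borel_measurable_integrable[OF integrable_L_window] by simp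
  show "(\<lambda>n. indicator {0..real n} s * L s) \<longlonglongrightarrow> L0 s" for s
  proof (rule tendsto_eventually)
    show "eventually (\<lambda>n. indicator {0..real n} s * L s = L0 s) sequentially"
      using eventually_ge_at_top[of "nat \<lceil>s\<rceil>"]
      by eventually_elim (auto simp: L0_def indicator_def of_nat_ceiling ceiling_le_iff nat_le_iff)
  qed
qed

lemma measurable_D [measurable]: "D \<in> borel_measurable borel"
  unfolding D_def[abs_def] by measurable

lemma measurable_P [measurable]: "P \<in> borel_measurable borel"
  unfolding P_def[abs_def] by measurable

lemma window: "L0 s * ker (t - s) = indicator {0..t} s * L s * ker (t - s)"
  by (auto simp: L0_def ker_def indicator_def)

lemma integrable_L0_ker: "integrable lborel (\<lambda>s. L0 s * ker (t - s))"
proof (rule Bochner_Integration.integrable_bound)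
  show "integrable lborel (\<lambda>s. \<gamma> * tr \<mu> * (indicator {0..t} s * L s))"
    by (intro integrable_mult_right integrable_L_window)
  show "AE s in lborel. norm (L0 s * ker (t - s)) \<le> norm (\<gamma> * tr \<mu> * (indicator {0..t} s * L s))"
  proof (intro AE_I2)
    fix s
    have "\<bar>indicator {0..t} s * L s\<bar> * ker (t - s) \<le> \<bar>indicator {0..t} s * L s\<bar> * (\<gamma> * tr \<mu>)"
      by (intro mult_left_mono ker_le) auto
    then show "norm (L0 s * ker (t - s)) \<le> norm (\<gamma> * tr \<mu> * (indicator {0..t} s * L s))"
      unfolding window using ker_nonneg gamma tr_pos by (simp add: abs_mult mult_ac)
  qed
qed measurable

lemma integrable_ker0: "integrable lborel (\<lambda>s. ker (t - s))" "(\<integral>s. ker (t - s) \<partial>lborel) = M 0"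
  using lborel_integral_reflect[of ker t] integrable_ker[OF admissible_0] integral_ker[OF admissible_0] by simp_all

lemma L_eq:
  assumes "t \<ge> 0"
  shows "L t = Finf + Phi t + (\<integral>s. L0 s * ker (t - s) \<partial>lborel)"
proof -
  have "L t = forcing \<mu> R R' \<gamma> \<theta> t + (LINT s:{0..t}|lborel. kernel \<mu> \<gamma> \<theta> (t - s) * L s)"
    using loss assms by (simp add: sdahb_loss_def)
  also have "(LINT s:{0..t}|lborel. kernel \<mu> \<gamma> \<theta> (t - s) * L s) = (\<integral>s. L0 s * ker (t - s) \<partial>lborel)"
    unfolding set_lebesgue_integral_def
    by (intro Bochner_Integration.integral_cong) (auto simp: L0_def ker_def indicator_def)
  finally show ?thesis using forcing_eq[OF assms] by simp
qed

lemma conv_D: "(\<integral>s. D s * ker (t - s) \<partial>lborel) = (\<integral>s. L0 s * ker (t - s) \<partial>lborel) - Linf * M 0"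
proof -
  have "(\<integral>s. D s * ker (t - s) \<partial>lborel) = (\<integral>s. L0 s * ker (t - s) - Linf * ker (t - s) \<partial>lborel)"
    by (simp add: D_def left_diff_distrib)
  also have "\<dots> = (\<integral>s. L0 s * ker (t - s) \<partial>lborel) - (\<integral>s. Linf * ker (t - s) \<partial>lborel)"
    by (intro Bochner_Integration.integral_diff integrable_L0_ker integrable_mult_right integrable_ker0)
  finally show ?thesis by (simp add: integrable_ker0)
qed

lemma Linf_eq: "Finf = Linf - Linf * M 0"
proof -
  have "Linf * (1 - M 0) = Finf" using M0 by (simp add: Linf_def)
  then show ?thesis by (simp add: right_diff_distrib)
qed

lemma renewal: "D t = P t + (\<integral>s. D s * ker (t - s) \<partial>lborel)"
proof (cases "t \<ge> 0")
  case True
  then have "D t = L t - Linf" "P t = Phi t" by (simp_all add: D_def L0_def P_def)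
  then show ?thesis using L_eq[OF True] Linf_eq unfolding conv_D by linarith
next
  case False
  then have "(\<integral>s. L0 s * ker (t - s) \<partial>lborel) = 0" unfolding window by simp
  then show ?thesis using False Linf_eq by (simp add: conv_D) (simp add: D_def L0_def P_def)
qed

lemma D_neg: "t < 0 \<Longrightarrow> D t = - Linf" by (simp add: D_def L0_def)

lemma integrable_D_ker: "integrable lborel (\<lambda>s. D s * ker (t - s))"
  unfolding D_def left_diff_distrib
  by (intro Bochner_Integration.integrable_diff integrable_L0_ker integrable_mult_right integrable_ker0)

lemma D_locally_bounded: "\<exists>b. \<forall>t\<le>T. \<bar>D t\<bar> \<le> b"
proof -
  define I where "I = (\<integral>s. norm (indicator {0..T} s * L s) \<partial>lborel)"
  have I: "I \<ge> 0" by (simp add: I_def)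
  have "\<bar>D t\<bar> \<le> \<bar>Linf\<bar> + (\<bar>Finf\<bar> + excess_bound 0 + \<gamma> * tr \<mu> * I)" if t: "t \<le> T" for t
  proof (cases "t \<ge> 0")
    case True
    have Phi: "\<bar>Phi t\<bar> \<le> excess_bound 0" using exp_Phi_le[OF admissible_0 True] Phi_nonneg[of t] by simp
    have "\<bar>\<integral>s. L0 s * ker (t - s) \<partial>lborel\<bar> \<le> (\<integral>s. norm (L0 s * ker (t - s)) \<partial>lborel)"
      using integral_norm_bound[of lborel "\<lambda>s. L0 s * ker (t - s)"] by simp
    also have "\<dots> \<le> (\<integral>s. \<gamma> * tr \<mu> * norm (indicator {0..T} s * L s) \<partial>lborel)"
    proof (intro integral_mono integrable_norm integrable_L0_ker integrable_mult_right integrable_L_window)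
      fix s
      have "norm (L0 s * ker (t - s)) = \<bar>indicator {0..t} s * L s\<bar> * ker (t - s)"
        unfolding window by (simp add: abs_mult ker_nonneg)
      also have "\<dots> \<le> \<bar>indicator {0..T} s * L s\<bar> * (\<gamma> * tr \<mu>)"
        using t ker_le ker_nonneg by (intro mult_mono) (auto simp: indicator_def)
      finally show "norm (L0 s * ker (t - s)) \<le> \<gamma> * tr \<mu> * norm (indicator {0..T} s * L s)" by (simp add: mult_ac)
    qed
    also have "\<dots> = \<gamma> * tr \<mu> * I" by (simp add: I_def)
    finally have "\<bar>L t\<bar> \<le> \<bar>Finf\<bar> + excess_bound 0 + \<gamma> * tr \<mu> * I"
      using L_eq[OF True] Phi by linarith
    then show ?thesis using True by (simp add: D_def L0_def)
  next
    case False
    have "0 \<le> \<gamma> * tr \<mu> * I" using gamma tr_pos I by simp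
    then show ?thesis using False D_neg[of t] excess_bound_nonneg[OF admissible_0] by (simp add: mult_nonneg_nonneg)
  qed
  then show ?thesis by blast
qed

text \<open>Let \<open>S\<close> be the supremum of \<open>exp (x * t) * \<bar>D t\<bar>\<close> up to a time \<open>T\<close>; it is finite because \<open>L\<close> is locally bounded. The weighted
renewal equation gives \<open>S \<le> c + S * M x\<close>, a bound that does not depend on \<open>T\<close>.\<close>

lemma D_exp_decay:
  assumes x: "x > 0" "admissible x" "M x < 1"
  shows "\<exists>C\<ge>0. \<forall>t. exp (x * t) * \<bar>D t\<bar> \<le> C"
proof -
  define c where "c = \<bar>Linf\<bar> + excess_bound x"
  have c: "c \<ge> 0" using excess_bound_nonneg[OF x(2)] by (simp add: c_def)
  have "exp (x * T) * \<bar>D T\<bar> \<le> c / (1 - M x)" for T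
  proof -
    obtain b where b: "\<And>t. t \<le> T \<Longrightarrow> \<bar>D t\<bar> \<le> b" using D_locally_bounded by blast
    define S where "S = (SUP t\<in>{..T}. exp (x * t) * \<bar>D t\<bar>)"
    have bdd: "bdd_above ((\<lambda>t. exp (x * t) * \<bar>D t\<bar>) ` {..T})"
      using b x by (intro bdd_aboveI2[of _ _ "exp (x * T) * b"] mult_mono) auto
    have S: "exp (x * t) * \<bar>D t\<bar> \<le> S" if "t \<le> T" for t
      unfolding S_def using that by (intro cSUP_upper bdd) auto
    have S0: "S \<ge> 0" using S[of T] by (rule order_trans[rotated]) auto
    have "exp (x * t) * \<bar>D t\<bar> \<le> c + S * M x" if t: "t \<le> T" for t
    proof (cases "t \<ge> 0")
      case True
      have "exp (x * t) * \<bar>\<integral>s. D s * ker (t - s) \<partial>lborel\<bar> \<le> exp (x * t) * (\<integral>s. norm (D s * ker (t - s)) \<partial>lborel)"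
        using integral_norm_bound[of lborel "\<lambda>s. D s * ker (t - s)"] by (intro mult_left_mono) auto
      also have "\<dots> = (\<integral>s. exp (x * t) * norm (D s * ker (t - s)) \<partial>lborel)" by simp
      also have "\<dots> \<le> (\<integral>s. S * (ker (t - s) * exp (x * (t - s))) \<partial>lborel)"
      proof (intro integral_mono integrable_mult_right integrable_norm integrable_D_ker)
        show "integrable lborel (\<lambda>s. ker (t - s) * exp (x * (t - s)))"
          using lborel_integral_reflect(2)[OF integrable_ker[OF x(2)]] .
        fix s
        show "exp (x * t) * norm (D s * ker (t - s)) \<le> S * (ker (t - s) * exp (x * (t - s)))"
        proof (cases "s \<le> t")
          case True
          have "exp (x * t) * norm (D s * ker (t - s)) = (exp (x * s) * \<bar>D s\<bar>) * (ker (t - s) * exp (x * (t - s)))"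
            using ker_nonneg[of "t - s"] by (simp add: abs_mult algebra_simps exp_diff)
          also have "\<dots> \<le> S * (ker (t - s) * exp (x * (t - s)))"
            using True t ker_nonneg by (intro mult_right_mono S) auto
          finally show ?thesis .
        qed (simp add: ker_def)
      qed
      also have "\<dots> = S * M x"
        using lborel_integral_reflect(1)[of "\<lambda>u. ker u * exp (x * u)" t] integral_ker[OF x(2)] by simp
      finally have 1: "exp (x * t) * \<bar>\<integral>s. D s * ker (t - s) \<partial>lborel\<bar> \<le> S * M x" .
      have "exp (x * t) * \<bar>D t\<bar> \<le> exp (x * t) * (\<bar>P t\<bar> + \<bar>\<integral>s. D s * ker (t - s) \<partial>lborel\<bar>)"
        using renewal[of t] by (intro mult_left_mono) auto
      also have "\<dots> = exp (x * t) * Phi t + exp (x * t) * \<bar>\<integral>s. D s * ker (t - s) \<partial>lborel\<bar>"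
        using True Phi_nonneg[of t] by (simp add: P_def distrib_left)
      also have "\<dots> \<le> c + S * M x" using 1 exp_Phi_le[OF x(2) True] by (simp add: c_def)
      finally show ?thesis .
    next
      case False
      then have "exp (x * t) * \<bar>D t\<bar> \<le> 1 * \<bar>Linf\<bar>"
        using x by (intro mult_mono) (auto simp: D_neg mult_le_0_iff)
      also have "\<dots> \<le> c + S * M x" using S0 M_nonneg[OF x(2)] excess_bound_nonneg[OF x(2)] by (simp add: c_def)
      finally show ?thesis .
    qed
    then have "S \<le> c + S * M x" unfolding S_def by (intro cSUP_least) auto
    then have "S \<le> c / (1 - M x)" using x by (simp add: field_simps)
    then show ?thesis using S[of T] by simp
  qed
  then show ?thesis using c x by (intro exI[of _ "c / (1 - M x)"]) auto
qed

lemma D_tendsto_0: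
  assumes "x > 0" "\<And>t. 0 \<le> t \<Longrightarrow> \<bar>D t\<bar> \<le> C * exp (- x * t)"
  shows "(D \<longlongrightarrow> 0) at_top"
proof (rule Lim_null_comparison)
  show "eventually (\<lambda>t. norm (D t) \<le> C * exp (- x * t)) at_top"
    using eventually_ge_at_top[of 0] by eventually_elim (use assms in simp)
  show "((\<lambda>t. C * exp (- x * t)) \<longlongrightarrow> 0) at_top" using assms(1) by real_asymp
qed

lemma exp_decay_bound:
  assumes "exp (x * t) * \<bar>D t\<bar> \<le> C"
  shows "\<bar>D t\<bar> \<le> C * exp (- x * t)"
  using assms by (simp add: exp_minus field_simps)

lemma Lim_L: "Lim at_top L = Linf"
proof -
  obtain x where x: "x > 0" "admissible x" "M x < 1" using exists_M_less_1[OF M0] by blast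
  obtain C where "\<And>t. exp (x * t) * \<bar>D t\<bar> \<le> C" using D_exp_decay[OF x] by blast
  then have "(D \<longlongrightarrow> 0) at_top" using x by (intro D_tendsto_0[of x C] exp_decay_bound) auto
  then have "((\<lambda>t. D t + Linf) \<longlongrightarrow> 0 + Linf) at_top" by (intro tendsto_intros)
  then have "(L \<longlongrightarrow> Linf) at_top"
    by (rule Lim_transform_eventually[OF tendsto_eq_rhs])
      (auto simp: D_def L0_def intro!: eventually_mono[OF eventually_ge_at_top[of 0]])
  then show ?thesis by (intro tendsto_Lim) auto
qed

lemma conv_rate_eq: "conv_rate L = Liminf at_top (\<lambda>t. neg_log (D t) / ereal t)"
  unfolding conv_rate_def Lim_L
  by (intro Liminf_eq eventually_mono[OF eventually_ge_at_top[of 0]]) (simp add: D_def L0_def)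

lemma conv_rate_ge:
  assumes x: "x > 0" "admissible x" "M x < 1"
  shows "ereal x \<le> conv_rate L"
proof -
  obtain C where C: "\<And>t. exp (x * t) * \<bar>D t\<bar> \<le> C" using D_exp_decay[OF x] by blast
  define C' where "C' = max C 1"
  have C': "C' > 0" "\<And>t. exp (x * t) * \<bar>D t\<bar> \<le> C'" using C by (auto simp: C'_def le_max_iff_disj)
  show ?thesis unfolding conv_rate_eq le_Liminf_iff
  proof (intro allI impI)
    fix y assume "y < ereal x"
    have "((\<lambda>t. x - ln C' / t) \<longlongrightarrow> x) at_top" by real_asymp
    then have lim: "((\<lambda>t. ereal (x - ln C' / t)) \<longlongrightarrow> ereal x) at_top" by simp
    show "eventually (\<lambda>t. y < neg_log (D t) / ereal t) at_top"
      using order_tendstoD(1)[OF lim \<open>y < ereal x\<close>] eventually_gt_at_top[of 0]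
    proof eventually_elim
      case (elim t)
      show ?case
      proof (cases "D t = 0")
        case True
        then show ?thesis using elim by (auto simp: neg_log_def)
      next
        case False
        have "ln (exp (x * t) * \<bar>D t\<bar>) \<le> ln C'" using False C' by (subst ln_le_cancel_iff) auto
        then have "x * t + ln \<bar>D t\<bar> \<le> ln C'" using False by (simp add: ln_mult)
        then have "(x * t - ln C') / t \<le> - ln \<bar>D t\<bar> / t" using elim by (intro divide_right_mono) auto
        then have "x - ln C' / t \<le> - ln \<bar>D t\<bar> / t" using elim by (simp add: diff_divide_distrib)
        then have "ereal (x - ln C' / t) \<le> neg_log (D t) / ereal t" using False elim by (simp add: neg_log_def)
        then show ?thesis using elim by (meson less_le_trans)
      qed
    qed
  qed
qed

lemma exp_decay_if_conv_rate_gt: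
  assumes "ereal x < conv_rate L"
  shows "\<exists>C. \<forall>t\<ge>0. \<bar>D t\<bar> \<le> C * exp (- x * t)"
proof -
  have "eventually (\<lambda>t. ereal x < neg_log (D t) / ereal t) at_top"
    using assms unfolding conv_rate_eq by (rule less_LiminfD)
  then have "eventually (\<lambda>t. \<bar>D t\<bar> \<le> exp (- x * t)) at_top"
    using eventually_gt_at_top[of 0]
  proof eventually_elim
    case (elim t)
    show ?case
    proof (cases "D t = 0")
      case False
      then have "x < - ln \<bar>D t\<bar> / t" using elim by (simp add: neg_log_def)
      then have "ln \<bar>D t\<bar> \<le> - x * t" using elim by (simp add: field_simps)
      then have "exp (ln \<bar>D t\<bar>) \<le> exp (- x * t)" by (subst exp_le_cancel_iff)
      then show ?thesis using False by simp
    qed simp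
  qed
  then obtain T where T: "\<And>t. t \<ge> T \<Longrightarrow> \<bar>D t\<bar> \<le> exp (- x * t)" by (auto simp: eventually_at_top_linorder)
  obtain b where b: "\<And>t. t \<le> T \<Longrightarrow> \<bar>D t\<bar> \<le> b" using D_locally_bounded by blast
  define b' where "b' = max b 0 * exp (\<bar>x\<bar> * \<bar>T\<bar>)"
  have "\<bar>D t\<bar> \<le> (1 + b') * exp (- x * t)" if "t \<ge> 0" for t
  proof (cases "t \<ge> T")
    case True
    have "exp (- x * t) \<le> (1 + b') * exp (- x * t)" by (simp add: b'_def)
    then show ?thesis using T[OF True] by linarith
  next
    case False
    have "x * t \<le> \<bar>x\<bar> * \<bar>T\<bar>" using False that by (intro order_trans[OF _ mult_mono[of "\<bar>x\<bar>" "\<bar>x\<bar>" t "\<bar>T\<bar>"]] mult_right_mono) auto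
    then have "1 \<le> exp (\<bar>x\<bar> * \<bar>T\<bar>) * exp (- x * t)" by (simp flip: exp_add)
    then have "max b 0 * 1 \<le> max b 0 * (exp (\<bar>x\<bar> * \<bar>T\<bar>) * exp (- x * t))" by (intro mult_left_mono) auto
    then have "\<bar>D t\<bar> \<le> b' * exp (- x * t)" using b[of t] False by (simp add: b'_def mult.assoc)
    then show ?thesis by (simp add: distrib_right) (smt (verit) exp_ge_zero)
  qed
  then show ?thesis by blast
qed

end

section \<open>The upper bound on the rate\<close>

text \<open>A quotient of holomorphic functions has no essential singularity, and boundedness along some approach to the point excludes a pole.\<close>

lemma holomorphic_quotient_extension:
  assumes h: "h holomorphic_on S" "open S" "connected S" and nz: "\<beta> \<in> S" "h \<beta> \<noteq> 0"
    and a: "a holomorphic_on ball z0 r0" and r0: "r0 > 0" "ball z0 r0 \<subseteq> S"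
    and bdd: "\<exists>\<^sub>F z in at z0. norm (a z / h z) \<le> B"
  obtains E r where "0 < r" "r \<le> r0" "E holomorphic_on ball z0 r"
    "\<And>z. z \<in> ball z0 r - {z0} \<Longrightarrow> h z \<noteq> 0 \<and> E z = a z / h z"
proof -
  have z0: "z0 \<in> S" using r0 by auto
  obtain r1 where r1: "0 < r1" "\<And>z. z \<in> ball z0 r1 - {z0} \<Longrightarrow> h z \<noteq> 0"
  proof (cases "h z0 = 0")
    case True
    with isolated_zeros[OF h z0 True nz] that show ?thesis by metis
  next
    case False
    have "isCont h z0"
      using h z0 by (meson continuous_on_eq_continuous_at holomorphic_on_imp_continuous_on)
    then obtain e where "e > 0" "\<And>z. dist z z0 < e \<Longrightarrow> h z \<noteq> 0"
      using continuous_at_avoid[of z0 h 0] False by (auto simp: dist_commute)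
    then show ?thesis using that[of e] by (auto simp: dist_commute)
  qed
  define r where "r = min r0 r1"
  have r: "0 < r" "r \<le> r0" "ball z0 r \<subseteq> ball z0 r0" "ball z0 r \<subseteq> S"
    "\<And>z. z \<in> ball z0 r - {z0} \<Longrightarrow> h z \<noteq> 0"
    using r0 r1 by (auto simp: r_def)
  have hr: "h holomorphic_on ball z0 r" and ar: "a holomorphic_on ball z0 r"
    using h(1) a r by (auto intro: holomorphic_on_subset)
  have q: "(\<lambda>z. a z / h z) holomorphic_on ball z0 r - {z0}"
    using r(5) by (intro holomorphic_intros holomorphic_on_subset[OF ar] holomorphic_on_subset[OF hr]) auto
  have iso: "isolated_singularity_at f z0" if "f holomorphic_on ball z0 r" for f
    using that r(1) by (intro isolated_singularity_at_holomorphic[of f "ball z0 r"])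
      (auto intro: holomorphic_on_subset)
  have "not_essential (\<lambda>z. a z / h z) z0"
    by (intro not_essential_divide iso hr ar not_essential_holomorphic[OF ar] not_essential_holomorphic[OF hr])
      (use r in auto)
  moreover have "\<not> is_pole (\<lambda>z. a z / h z) z0"
  proof
    assume "is_pole (\<lambda>z. a z / h z) z0"
    then have "eventually (\<lambda>z. norm (a z / h z) \<ge> B + 1) (at z0)"
      unfolding is_pole_def filterlim_at_infinity_conv_norm_at_top filterlim_at_top by blast
    then have "eventually (\<lambda>z. \<not> norm (a z / h z) \<le> B) (at z0)"
      by eventually_elim linarith
    then show False using bdd by (simp add: frequently_def)
  qed
  ultimately obtain c where c: "(\<lambda>z. a z / h z) \<midarrow>z0\<rightarrow> c" by (auto simp: not_essential_def)
  show ?thesis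
  proof (rule that[OF r(1,2)])
    show "(\<lambda>z. if z = z0 then c else a z / h z) holomorphic_on ball z0 r"
      using removable_singularity[OF q _ c] by simp
  qed (use r(5) in auto)
qed

lemma has_bochner_integral_exp_neg:
  fixes x :: real
  assumes "x > 0"
  shows "has_bochner_integral lborel (\<lambda>t. indicator {..<0} t * exp (x * t)) (1 / x)"
proof -
  have "has_bochner_integral lborel (\<lambda>t. exp (- x * (0 + (- 1) * t)) * indicator {0..} (0 + (- 1) * t)) (1 / x)"
    using lborel_has_bochner_integral_real_affine_iff[of "-1" "\<lambda>t. exp (- x * t) * indicator {0..} t" "1 / x" 0]
      has_bochner_integral_exp_decay[OF assms] by simp
  then show ?thesis
  proof (rule has_bochner_integral_cong_AE[THEN iffD1, rotated -1])
    show "AE t in lborel. exp (- x * (0 + (- 1) * t)) * indicator {0..} (0 + (- 1) * t) = indicator {..<0} t * exp (x * t)"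
      using AE_lborel_singleton[of 0] by eventually_elim (auto simp: indicator_def)
  qed measurable
qed

context sdahb_solution
begin

definition D_pos :: "real \<Rightarrow> real" where "D_pos t = indicator {0..} t * D t"

lemma measurable_D_pos [measurable]: "D_pos \<in> borel_measurable borel"
  unfolding D_pos_def[abs_def] by measurable

text \<open>The transform of the renewal equation over the whole line. The negative half-line contributes \<open>- Linf / x\<close> and
\<open>- Finf / x\<close>.\<close>

lemma two_sided_laplace:
  assumes x: "x > 0" "admissible x" and int: "integrable lborel (\<lambda>t. D_pos t * exp (x * t))"
  shows "((\<integral>t. D_pos t * exp (x * t) \<partial>lborel) - Linf / x) * (1 - M x) = (\<integral>l. excess_lap x l \<partial>\<mu>) - Finf / x"
proof -
  note neg = has_bochner_integral_exp_neg[OF x(1), unfolded has_bochner_integral_iff]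
  have D_split: "D t * exp (x * t) = D_pos t * exp (x * t) - Linf * (indicator {..<0} t * exp (x * t))" for t
    by (cases "t < 0") (auto simp: D_pos_def D_neg)
  have D_int: "integrable lborel (\<lambda>t. D t * exp (x * t))"
    unfolding D_split using neg int by auto
  have D_val: "(\<integral>t. D t * exp (x * t) \<partial>lborel) = (\<integral>t. D_pos t * exp (x * t) \<partial>lborel) - Linf / x"
    unfolding D_split using neg int by (subst Bochner_Integration.integral_diff) auto
  have P_split: "P t * exp (x * t) = indicator {0..} t * (exp (x * t) * Phi t) - Finf * (indicator {..<0} t * exp (x * t))" for t
    by (simp add: P_def algebra_simps)
  have P_int: "integrable lborel (\<lambda>t. P t * exp (x * t))"
    unfolding P_split using neg integrable_Phi[OF x(2)] by auto
  have P_val: "(\<integral>t. P t * exp (x * t) \<partial>lborel) = (\<integral>l. excess_lap x l \<partial>\<mu>) - Finf / x"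
    unfolding P_split using neg integrable_Phi[OF x(2)] integral_Phi[OF x(2)]
    by (subst Bochner_Integration.integral_diff) auto
  have conv: "(\<integral>s. (D s * exp (x * s)) * (ker (t - s) * exp (x * (t - s))) \<partial>lborel) = D t * exp (x * t) - P t * exp (x * t)" for t
  proof -
    have "(D s * exp (x * s)) * (ker (t - s) * exp (x * (t - s))) = exp (x * t) * (D s * ker (t - s))" for s
      by (simp add: algebra_simps exp_diff)
    then have "(\<integral>s. (D s * exp (x * s)) * (ker (t - s) * exp (x * (t - s))) \<partial>lborel) = exp (x * t) * (\<integral>s. D s * ker (t - s) \<partial>lborel)"
      by (simp only: integral_mult_right_zero)
    also have "\<dots> = exp (x * t) * (D t - P t)" using renewal[of t] by simp
    finally show ?thesis by (simp add: algebra_simps)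
  qed
  have "(\<integral>t. D t * exp (x * t) \<partial>lborel) - (\<integral>t. P t * exp (x * t) \<partial>lborel) = (\<integral>t. D t * exp (x * t) \<partial>lborel) * M x"
    using integral_convolution[OF D_int integrable_ker[OF x(2)]] D_int P_int integral_ker[OF x(2)]
    unfolding conv by simp
  then show ?thesis unfolding D_val P_val by (simp only: right_diff_distrib mult_1_right)
qed

text \<open>The assumption \<open>RR'\<close> is what makes the factor \<open>h\<close> in the functional equation nonzero somewhere.\<close>

lemma conv_rate_le:
  assumes nondeg: "nondegenerate \<mu> R R' \<gamma> \<theta>" and RR': "\<not> (R = 0 \<and> R' = 0)"
  shows "conv_rate L \<le> ereal (4 * lm / tr \<mu>)"
proof (rule ccontr)
  define x0 where "x0 = 4 * lm / tr \<mu>"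
  assume "\<not> conv_rate L \<le> ereal (4 * lm / tr \<mu>)"
  then have "ereal x0 < conv_rate L" by (simp add: x0_def)
  then obtain x1 where x1: "x0 < x1" "ereal x1 < conv_rate L"
    using ereal_dense2 by force
  have x0: "x0 > 0" using lm tr_pos by (simp add: x0_def)
  obtain C where C: "\<And>t. 0 \<le> t \<Longrightarrow> \<bar>D t\<bar> \<le> C * exp (- x1 * t)"
    using exp_decay_if_conv_rate_gt[OF x1(2)] by blast
  have supp: "D_pos t = 0" if "t < 0" for t using that by (simp add: D_pos_def)
  have D_pos_bound: "\<bar>D_pos t\<bar> \<le> C * exp (- x1 * t)" if "0 \<le> t" for t
    using C[OF that] that by (simp add: D_pos_def)
  have C0: "C \<ge> 0" using D_pos_bound[of 0] by simp
  note lap_hol = laplace_holomorphic[OF supp measurable_D_pos D_pos_bound]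
  have D_pos_int: "integrable lborel (\<lambda>t. D_pos t * exp (x * t))" if "x < x1" for x
    using exp_decay_integrable[OF supp measurable_D_pos D_pos_bound that] .

  have M_ne_1: "M x \<noteq> 1" if x: "0 < x" "x < x1" "admissible x" for x
  proof
    assume M1: "M x = 1"
    have Phi0: "(\<integral>t. indicator {0..} t * (exp (x * t) * Phi t) \<partial>lborel) = Finf / x"
      using two_sided_laplace[OF x(1,3) D_pos_int[OF x(2)]] integral_Phi[OF x(3)] M1 by simp
    have "((\<lambda>t. Phi t) \<longlongrightarrow> 0) at_top"
    proof (rule Lim_null_comparison)
      show "eventually (\<lambda>t. norm (Phi t) \<le> excess_bound x * exp (- x * t)) at_top"
        using eventually_ge_at_top[of 0]
      proof eventually_elim
        case (elim t)
        then show ?case using exp_Phi_le[OF x(3) elim] Phi_nonneg[of t] by (simp add: exp_minus field_simps)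
      qed
      show "((\<lambda>t. excess_bound x * exp (- x * t)) \<longlongrightarrow> 0) at_top" using x by real_asymp
    qed
    then have "((\<lambda>t. Finf + Phi t) \<longlongrightarrow> Finf + 0) at_top" by (intro tendsto_intros)
    then have "(forcing \<mu> R R' \<gamma> \<theta> \<longlongrightarrow> Finf) at_top"
      by (rule Lim_transform_eventually[OF tendsto_eq_rhs])
        (auto intro!: eventually_mono[OF eventually_ge_at_top[of 0]] simp: forcing_eq)
    then have Finf: "Lim at_top (forcing \<mu> R R' \<gamma> \<theta>) = Finf" by (intro tendsto_Lim) auto
    have "(LINT t:{0..}|lborel. exp (x * t) * kernel \<mu> \<gamma> \<theta> t) = 1"
      using integral_kernel[OF x(3)] M1 by (simp add: set_lebesgue_integral_def)
    then have "(LINT t:{0..}|lborel. exp (x * t) * (forcing \<mu> R R' \<gamma> \<theta> t - Finf)) \<noteq> Finf / x"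
      using nondeg x unfolding nondegenerate_def Let_def Finf by blast
    also have "(LINT t:{0..}|lborel. exp (x * t) * (forcing \<mu> R R' \<gamma> \<theta> t - Finf))
        = (\<integral>t. indicator {0..} t * (exp (x * t) * Phi t) \<partial>lborel)"
      unfolding set_lebesgue_integral_def
      by (intro Bochner_Integration.integral_cong) (auto simp: indicator_def forcing_eq)
    finally show False using Phi0 by simp
  qed
  \<comment> \<open>By the intermediate value theorem, as \<open>M 0 < 1\<close>.\<close>
  have M_lt_1: "M x < 1" if x: "0 < x" "x < x1" "admissible x" for x
  proof (rule ccontr)
    assume "\<not> M x < 1"
    then have "\<exists>y\<ge>0. y \<le> x \<and> M y = 1"
      using M0 x by (intro IVT' M_continuous_on) auto
    then obtain y where y: "0 \<le> y" "y \<le> x" "M y = 1" by blast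
    moreover have "y \<noteq> 0" using y M0 by auto
    ultimately show False using M_ne_1[of y] admissible_mono(1)[OF x(3) y(2)] x by simp
  qed

  \<comment> \<open>The abscissa of convergence: the smaller root of \<open>disc \<theta> (\<gamma> * lm)\<close>, or \<open>\<theta>\<close> if there is no real root.\<close>
  define X where "X = \<theta> - sqrt (max 0 (\<theta>\<^sup>2 - 4 * \<gamma> * lm))"
  have disc_sq: "disc \<theta> (\<gamma> * lm) x = (\<theta> - x)\<^sup>2 - (\<theta>\<^sup>2 - 4 * \<gamma> * lm)" for x
    by (simp add: disc_def power2_eq_square algebra_simps)
  have admissible_X: "admissible x" if "x < X" for x
  proof -
    have lt: "sqrt (max 0 (\<theta>\<^sup>2 - 4 * \<gamma> * lm)) < \<theta> - x" using that by (simp add: X_def)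
    then have "max 0 (\<theta>\<^sup>2 - 4 * \<gamma> * lm) < (\<theta> - x)\<^sup>2" 
      using power_strict_mono[OF lt, of 2] by simp
    moreover have "x < \<theta>" using lt by (smt (verit) real_sqrt_ge_zero max.cobounded1)
    ultimately show ?thesis by (simp add: admissible_def disc_sq)
  qed
  have "sqrt (max 0 (\<theta>\<^sup>2 - 4 * \<gamma> * lm)) < sqrt (\<theta>\<^sup>2)"
    using theta gamma lm by (subst real_sqrt_less_iff) auto
  then have X_pos: "X > 0" using theta by (simp add: X_def)
  have X_x1: "X < x1"
  proof (rule ccontr)
    assume "\<not> X < x1"
    then obtain x where x: "x0 < x" "x < x1" "x < X" using dense[OF x1(1)] by force
    have "M x \<le> 1" using M_lt_1[of x] x x0 admissible_X by force
    then show False using rate_le_if_M_le_1[OF admissible_X[OF x(3)]] x x0 by (simp add: x0_def)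
  qed
  \<comment> \<open>Otherwise \<open>X = \<theta>\<close>, and the lower bound on \<open>M\<close>, which has a pole at \<open>\<theta>\<close>, reaches \<open>1\<close> before.\<close>
  have overdamped: "\<theta>\<^sup>2 > 4 * \<gamma> * lm"
  proof (rule ccontr)
    assume "\<not> ?thesis"
    then have X: "X = \<theta>" by (simp add: X_def)
    define x where "x = \<theta> - \<gamma> * tr \<mu> / 2"
    have gt: "\<gamma> * tr \<mu> > 0" using gamma tr_pos by simp
    have x: "0 < x" "x < X" using M0 theta gt by (auto simp: x_def M_0 X field_simps)
    have "1 \<le> M x" using M_lower[OF admissible_X[OF x(2)]] x gamma tr_pos by (auto simp: x_def split: if_splits)
    then show False using M_lt_1[of x] x X_x1 admissible_X by force
  qed
  define s where "s = sqrt (\<theta>\<^sup>2 - 4 * \<gamma> * lm)"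
  have s: "s > 0" "X = \<theta> - s" "s\<^sup>2 = \<theta>\<^sup>2 - 4 * \<gamma> * lm" using overdamped by (auto simp: s_def X_def)

  \<comment> \<open>Both \<open>h\<close> and \<open>a\<close> contain a factor \<open>z\<^sup>2\<close>, which clears the poles of \<open>kappa\<close> and of \<open>Linf / x\<close> at \<open>0\<close>.\<close>
  define H where "H = {z. Re z > - x1}"
  define h where "h z = z\<^sup>2 * laplace D_pos z + of_real Linf * z - of_real R * (2 * of_real \<theta> + z) * z / (2 * of_real \<gamma>) + 2 * of_real R'" for z :: complex
  define a where "a z = z\<^sup>2 * laplace D_pos z + of_real Linf * z - of_real R' * z / 2
      + of_real (tr \<mu>) * (of_real (\<gamma> * R') / (of_real \<theta> + z) - of_real R * z / 2)" for z :: complex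
  have H: "open H" "connected H"
    by (auto simp: H_def open_halfspace_Re_gt convex_connected convex_halfspace_Re_gt)
  have h_hol: "h holomorphic_on H" unfolding h_def H_def
    using gamma by (intro holomorphic_intros lap_hol) auto
  have functional_eq: "h (- of_real x) * of_real (M x) = a (- of_real x)" if x: "0 < x" "x < X" for x
  proof -
    define d where "d = (\<integral>t. D_pos t * exp (x * t) \<partial>lborel)"
    have lin: "(A + k) * m = A + r + b" if "A * (1 - m) = k * m - r - b" for A m k r b :: real
      using that by (simp add: algebra_simps)
    have expand: "(A + r + (b + c) * T) * y = A * y + r * y + T * (b * y + c * y)" for A r b c T y :: real
      by (simp add: algebra_simps)
    have factor: "(A * y + k * y) * m = (A + k) * m * y" for A k m y :: real
      by (simp add: algebra_simps)
    have "(d - Linf / x) * (1 - M x) = kappa x * M x - R' / (2 * x)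
           - (\<gamma> * R' / ((\<theta> - x) * x\<^sup>2) + R / (2 * x)) * tr \<mu>"
      using two_sided_laplace[OF x(1) admissible_X[OF x(2)] D_pos_int] integral_excess_lap[OF admissible_X[OF x(2)] x(1)] x X_x1
      by (simp add: d_def)
    note eq = lin[OF this]
    have parts: "(\<gamma> * R' / ((\<theta> - x) * x\<^sup>2)) * x\<^sup>2 = \<gamma> * R' / (\<theta> - x)"
      "(R' / (2 * x)) * x\<^sup>2 = R' * x / 2" "(R / (2 * x)) * x\<^sup>2 = R * x / 2"
      using x by (simp_all add: power2_eq_square)
    have "Linf / x * x\<^sup>2 = Linf * x" using x by (simp add: power2_eq_square)
    then have part: "(d - Linf / x) * x\<^sup>2 = x\<^sup>2 * d - Linf * x"
      by (simp only: left_diff_distrib mult.commute[of d])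
    have "kappa x * x\<^sup>2 = R * (2 * \<theta> - x) * x / (2 * \<gamma>) + 2 * R'"
      using x gamma by (simp add: kappa_def distrib_right power2_eq_square)
    then have "(x\<^sup>2 * d - Linf * x + R * (2 * \<theta> - x) * x / (2 * \<gamma>) + 2 * R') * M x
        = ((d - Linf / x) * x\<^sup>2 + kappa x * x\<^sup>2) * M x" unfolding part by (simp only: add.assoc)
    also have "\<dots> = (d - Linf / x + kappa x) * M x * x\<^sup>2" by (rule factor)
    also have "\<dots> = (x\<^sup>2 * d - Linf * x) + R' * x / 2 + tr \<mu> * (\<gamma> * R' / (\<theta> - x) + R * x / 2)"
      unfolding eq expand parts part ..
    finally have real: "(x\<^sup>2 * d - Linf * x + R * (2 * \<theta> - x) * x / (2 * \<gamma>) + 2 * R') * M x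
       = x\<^sup>2 * d - Linf * x + R' * x / 2 + tr \<mu> * (\<gamma> * R' / (\<theta> - x) + R * x / 2)" .
    have "h (- of_real x) = of_real (x\<^sup>2 * d - Linf * x + R * (2 * \<theta> - x) * x / (2 * \<gamma>) + 2 * R')"
      unfolding h_def laplace_real d_def[symmetric] by simp
    moreover have "a (- of_real x) = of_real (x\<^sup>2 * d - Linf * x + R' * x / 2 + tr \<mu> * (\<gamma> * R' / (\<theta> - x) + R * x / 2))"
      unfolding a_def laplace_real d_def[symmetric] by simp
    ultimately show ?thesis by (simp only: of_real_mult[symmetric] real)
  qed
  have "\<exists>\<beta>\<in>H. h \<beta> \<noteq> 0"
  proof (rule ccontr)
    assume "\<not> ?thesis"
    then have zero: "h z = 0" if "z \<in> H" for z using that by blast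
    have "R' = 0" using zero[of 0] x0 x1 by (simp add: H_def h_def)
    then have "R > 0" using R RR' by auto
    \<comment> \<open>Large enough for \<open>R * x / (2 * \<gamma>)\<close> to exceed the bound \<open>C + \<bar>Linf\<bar>\<close> on the remaining terms of \<open>h\<close>, divided by \<open>x\<close>.\<close>
    define x where "x = 2 * \<gamma> * (C + \<bar>Linf\<bar> + 1) / R"
    have x: "x > 0" using gamma C0 \<open>R > 0\<close> by (simp add: x_def)
    have "h (of_real x) = 0" using x x0 x1 by (intro zero) (simp add: H_def)
    then have "of_real x * (of_real x * laplace D_pos (of_real x) + of_real Linf) = of_real x * of_real (R * (2 * \<theta> + x) / (2 * \<gamma>))"
      unfolding h_def using \<open>R' = 0\<close> by (simp add: power2_eq_square algebra_simps)
    then have "of_real x * laplace D_pos (of_real x) + of_real Linf = complex_of_real (R * (2 * \<theta> + x) / (2 * \<gamma>))"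
      using x by (simp only: mult_cancel_left of_real_eq_0_iff) simp
    then have "norm (complex_of_real (R * (2 * \<theta> + x) / (2 * \<gamma>))) \<le> norm (of_real x * laplace D_pos (of_real x)) + norm (complex_of_real Linf)"
      by (metis norm_triangle_ineq)
    then have "R * (2 * \<theta> + x) / (2 * \<gamma>) \<le> x * norm (laplace D_pos (of_real x)) + \<bar>Linf\<bar>"
    proof -
      have "0 \<le> R * (2 * \<theta> + x) / (2 * \<gamma>)" using x theta gamma \<open>R > 0\<close> by simp
      moreover assume "norm (complex_of_real (R * (2 * \<theta> + x) / (2 * \<gamma>))) \<le> norm (of_real x * laplace D_pos (of_real x)) + norm (complex_of_real Linf)"
      ultimately show ?thesis unfolding norm_mult norm_of_real using x by (simp only: abs_of_nonneg abs_of_pos)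
    qed
    moreover have "norm (laplace D_pos (of_real x)) \<le> C / x"
    proof (rule laplace_bound[OF supp measurable_D_pos _ x])
      show "\<bar>D_pos t\<bar> \<le> C" if "0 \<le> t" for t
        using D_pos_bound[OF that] mult_left_le[of "exp (- x1 * t)" C] C0 x0 x1 that by auto
    qed
    then have "x * norm (laplace D_pos (of_real x)) \<le> C" using x by (simp add: field_simps)
    ultimately have "R * (2 * \<theta> + x) / (2 * \<gamma>) \<le> C + \<bar>Linf\<bar>" by linarith
    moreover have "R * (2 * \<theta> + x) / (2 * \<gamma>) = R * \<theta> / \<gamma> + (C + \<bar>Linf\<bar> + 1)"
      using gamma \<open>R > 0\<close> by (simp add: x_def field_simps)
    moreover have "R * \<theta> / \<gamma> > 0" using \<open>R > 0\<close> theta gamma by simp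
    ultimately show False by linarith
  qed
  then obtain \<beta> where beta: "\<beta> \<in> H" "h \<beta> \<noteq> 0" by blast
  define z0 where "z0 = - complex_of_real X"
  \<comment> \<open>Within this radius, the transform of \<open>D\<close> converges and the pole of \<open>a\<close> at \<open>- \<theta>\<close> is avoided.\<close>
  define r0 where "r0 = min (x1 - X) s"
  have r0: "r0 > 0" "r0 \<le> x1 - X" "r0 \<le> s" using X_x1 s by (auto simp: r0_def)
  have Re_ball: "Re z > - X - r0" if "z \<in> ball z0 r0" for z
  proof -
    have "\<bar>Re (z - z0)\<bar> < r0" using that abs_Re_le_cmod[of "z - z0"] by (simp add: dist_norm norm_minus_commute)
    then show ?thesis by (simp add: z0_def)
  qed
  have sub: "ball z0 r0 \<subseteq> H" using Re_ball r0 by (force simp: H_def)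
  have a_hol: "a holomorphic_on ball z0 r0" unfolding a_def
  proof (intro holomorphic_intros holomorphic_on_subset[OF lap_hol])
    show "ball z0 r0 \<subseteq> {z. - x1 < Re z}" using sub by (simp add: H_def)
    show "of_real \<theta> + z \<noteq> 0" if "z \<in> ball z0 r0" for z
      using Re_ball[OF that] r0 s by (auto simp: complex_eq_iff)
  qed auto
  have freq: "\<exists>\<^sub>F z in at z0. norm (a z / h z) \<le> 1"
    unfolding frequently_def
  proof
    assume ev: "eventually (\<lambda>z. \<not> norm (a z / h z) \<le> 1) (at z0)"
    have "filterlim (\<lambda>x. - complex_of_real x) (at z0) (at_left X)"
      unfolding filterlim_at z0_def by (auto simp: eventually_at_filter intro!: tendsto_intros)
    then have "eventually (\<lambda>x. \<not> norm (a (- of_real x) / h (- of_real x)) \<le> 1) (at_left X)"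
      using ev unfolding filterlim_iff by blast
    moreover have "eventually (\<lambda>x. x \<in> {0<..<X}) (at_left X)" using X_pos eventually_at_left_real by blast
    ultimately have "eventually (\<lambda>x. False) (at_left X)"
    proof eventually_elim
      case (elim x)
      then have x: "0 < x" "x < X" by auto
      have "norm (a (- of_real x) / h (- of_real x)) \<le> 1"
      proof (cases "h (- of_real x) = 0")
        case False
        then have "a (- of_real x) / h (- of_real x) = of_real (M x)"
          by (simp flip: functional_eq[OF x])
        then show ?thesis using M_lt_1[of x] M_nonneg[of x] admissible_X[of x] x X_x1 by simp
      qed simp
      then show False using elim by blast
    qed
    then show False by simp
  qed
  obtain E r where E: "0 < r" "r \<le> r0" "E holomorphic_on ball z0 r"
    "\<And>z. z \<in> ball z0 r - {z0} \<Longrightarrow> h z \<noteq> 0 \<and> E z = a z / h z"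
    by (rule holomorphic_quotient_extension[OF h_hol H beta a_hol r0(1) sub freq]) blast
  define \<rho> where "\<rho> = min r X"
  have rho: "0 < \<rho>" "\<rho> \<le> r" "\<rho> \<le> X" using E X_pos by (auto simp: \<rho>_def)
  have "\<exists>x>X. integrable lborel (\<lambda>t. ker t * exp (x * t))"
  proof (rule landau_laplace[where r = \<rho> and E = E])
    show "E holomorphic_on ball (- complex_of_real X) \<rho>"
      using E(3) by (rule holomorphic_on_subset) (use rho in \<open>auto simp: z0_def\<close>)
    show "E (- complex_of_real x) = complex_of_real (\<integral>t. ker t * exp (x * t) \<partial>lborel)"
      if x: "X - \<rho> < x" "x < X" for x
    proof -
      have "- complex_of_real x \<in> ball z0 r - {z0}"
        using x rho by (auto simp: z0_def dist_norm simp flip: of_real_diff of_real_minus)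
      from E(4)[OF this] have "h (- of_real x) \<noteq> 0" "E (- of_real x) = a (- of_real x) / h (- of_real x)" by auto
      moreover have "0 < x" using x rho by simp
      ultimately have "E (- of_real x) = of_real (M x)" by (simp flip: functional_eq[OF \<open>0 < x\<close> x(2)])
      then show ?thesis using integral_ker[OF admissible_X[OF x(2)]] by simp
    qed
  qed (use ker_nonneg rho admissible_X integrable_ker in \<open>auto simp: ker_def\<close>)
  then obtain y where y: "X < y" "integrable lborel (\<lambda>t. ker t * exp (y * t))" by blast
  define x where "x = min y (\<theta> - s / 2)"
  have x: "X < x" "x < \<theta>" "x \<le> y" using y s by (auto simp: x_def)
  have "integrable lborel (\<lambda>t. ker t * exp (x * t))"
  proof (rule Bochner_Integration.integrable_bound[OF y(2)])
    show "AE t in lborel. norm (ker t * exp (x * t)) \<le> norm (ker t * exp (y * t))"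
    proof (intro AE_I2)
      fix t
      show "norm (ker t * exp (x * t)) \<le> norm (ker t * exp (y * t))"
        using x ker_nonneg[of t] by (cases "t \<ge> 0") (auto simp: ker_def intro!: mult_left_mono mult_right_mono)
    qed
  qed measurable
  then have "integrable lborel (\<lambda>t. indicator {0..} t * (exp (x * t) * kernel \<mu> \<gamma> \<theta> t))"
    by (simp add: ker_def mult_ac)
  moreover have "disc \<theta> (\<gamma> * lm) x < 0"
  proof -
    have "(\<theta> - x)\<^sup>2 < s\<^sup>2" using x s by (intro power_strict_mono) auto
    then show ?thesis by (simp add: disc_sq s)
  qed
  ultimately show False using kernel_not_integrable[of x] x X_pos by simp
qed

end

theorem propositionE3:
  fixes \<mu> :: "real measure" and lm lp ell \<alpha> R R' :: real
  assumes "spectral_measure \<mu> lm lp ell \<alpha>"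
    and "R \<ge> 0" and "R' \<ge> 0" and "\<not> (R = 0 \<and> R' = 0)"
  shows "(\<forall>\<gamma> \<theta> L. \<theta> = 2 \<longrightarrow> \<gamma> = \<theta> / tr \<mu> \<longrightarrow> sdahb_loss \<mu> R R' \<gamma> \<theta> L \<longrightarrow>
            ereal (\<gamma> * lm * \<theta> / (2 * \<gamma> * lm + \<theta>^2)) \<le> conv_rate L \<and>
            \<gamma> * lm * \<theta> / (2 * \<gamma> * lm + \<theta>^2) = 2 * \<gamma> * lm / (2 * \<gamma> * lm + 4))
       \<and> Sup {conv_rate L | \<gamma> \<theta> L. \<gamma> > 0 \<and> \<theta> > 0 \<and> kernel_norm \<mu> \<gamma> \<theta> < 1 \<and>
               sdahb_loss \<mu> R R' \<gamma> \<theta> L \<and> nondegenerate \<mu> R R' \<gamma> \<theta>}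
           \<le> ereal (4 * lm / tr \<mu>)"
proof (intro conjI allI impI)
  fix \<gamma> \<theta> :: real and L :: "real \<Rightarrow> real"
  assume two: "\<theta> = 2" and gam: "\<gamma> = \<theta> / tr \<mu>" and loss: "sdahb_loss \<mu> R R' \<gamma> \<theta> L"
  \<comment> \<open>Positivity of the trace does not depend on the parameters; it is taken from an instance with arbitrary ones.\<close>
  interpret unit: sdahb \<mu> lm lp ell \<alpha> 1 1 R R'
    using assms by unfold_locales auto
  interpret sdahb \<mu> lm lp ell \<alpha> \<gamma> \<theta> R R'
    using assms two gam unit.tr_pos by unfold_locales auto
  have half: "M 0 = 1 / 2" unfolding M_0 using two gam unit.tr_pos by simp
  interpret sdahb_solution \<mu> lm lp ell \<alpha> \<gamma> \<theta> R R' L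
    using loss half by unfold_locales auto
  define b where "b = \<gamma> * lm"
  \<comment> \<open>The claimed rate, with \<open>b = \<gamma> * lm\<close>.\<close>
  define x where "x = 2 * b / (2 * b + 4)"
  have b: "b > 0" using lm gamma by (simp add: b_def)
  have "(2 - x) * (4 * b - 4 * x) > 4 * b"
  proof -
    have 1: "2 - x = (b + 4) / (b + 2)" "4 * b - 4 * x = 4 * b * (b + 1) / (b + 2)"
      using b by (simp_all add: x_def field_simps)
    have "4 * b * (b + 2)\<^sup>2 < 4 * b * ((b + 4) * (b + 1))"
      using b by (intro mult_strict_left_mono) (auto simp: power2_eq_square algebra_simps)
    then have "4 * b < 4 * b * ((b + 4) * (b + 1)) / (b + 2)\<^sup>2"
      using b by (simp add: pos_less_divide_eq)
    also have "\<dots> = (b + 4) / (b + 2) * (4 * b * (b + 1) / (b + 2))"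
      by (simp only: times_divide_times_eq power2_eq_square mult_ac)
    finally show ?thesis unfolding 1 .
  qed
  moreover have x2: "x < 2" "x > 0" using b by (auto simp: x_def divide_simps)
  moreover have "(2 - x) * disc \<theta> b x = (2 - x) * (4 * b - 4 * x) + (2 - x) * x\<^sup>2"
    by (simp add: disc_def two algebra_simps)
  ultimately have big: "(2 - x) * disc \<theta> b x > 4 * b"
    using mult_nonneg_nonneg[of "2 - x" "x\<^sup>2"] zero_le_power2[of x] by linarith
  then have "0 < (2 - x) * disc \<theta> b x" using b by linarith
  then have "disc \<theta> b x > 0" using x2 by (simp add: zero_less_mult_iff)
  then have d: "(\<theta> - x) * disc \<theta> b x > 4 * b" "disc \<theta> b x > 0" using big two by auto
  have admissible: "admissible x" unfolding admissible_def b_def[symmetric] using d x2 two by auto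
  have "M x \<le> 1 / 2 * (2 * (4 * b) / ((\<theta> - x) * disc \<theta> b x))"
    using M_upper[OF admissible] x2 unfolding half b_def by (simp add: two mult_ac)
  also have "\<dots> < 1" using d b x2 two by (simp add: divide_less_eq)
  finally have "ereal x \<le> conv_rate L" using conv_rate_ge x2 admissible by blast
  moreover show eq: "\<gamma> * lm * \<theta> / (2 * \<gamma> * lm + \<theta>^2) = 2 * \<gamma> * lm / (2 * \<gamma> * lm + 4)"
    by (simp add: two)
  ultimately show "ereal (\<gamma> * lm * \<theta> / (2 * \<gamma> * lm + \<theta>^2)) \<le> conv_rate L"
    unfolding eq by (simp add: x_def b_def mult_ac)
next
  show "Sup {conv_rate L | \<gamma> \<theta> L. \<gamma> > 0 \<and> \<theta> > 0 \<and> kernel_norm \<mu> \<gamma> \<theta> < 1 \<and>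
               sdahb_loss \<mu> R R' \<gamma> \<theta> L \<and> nondegenerate \<mu> R R' \<gamma> \<theta>}
           \<le> ereal (4 * lm / tr \<mu>)"
  proof (rule Sup_least, clarify)
    fix \<gamma> \<theta> :: real and L :: "real \<Rightarrow> real"
    assume *: "0 < \<gamma>" "0 < \<theta>" "kernel_norm \<mu> \<gamma> \<theta> < 1" "sdahb_loss \<mu> R R' \<gamma> \<theta> L" "nondegenerate \<mu> R R' \<gamma> \<theta>"
    interpret sdahb \<mu> lm lp ell \<alpha> \<gamma> \<theta> R R'
      using assms * by unfold_locales auto
    interpret sdahb_solution \<mu> lm lp ell \<alpha> \<gamma> \<theta> R R' L
      using * kernel_norm_eq by unfold_locales auto
    show "conv_rate L \<le> ereal (4 * lm / tr \<mu>)"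
      using conv_rate_le * assms by blast
  qed
qed

end
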